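(* Let $\mathcal{J}$ be a Euclidean Jordan algebra of rank $r$ with cone of squares $\mathcal{K}$, let $A=\{a_1,\dots,a_m\}\in\mathcal{J}^m$, $b\in\mathbb{R}^m$, $\rho=\max_{i\in[m]}\|a_i\|_\infty$, and $\alpha>0$. Suppose there exists $x\in\mathcal{K}$ with $\mathrm{Tr}(x)=1$ and $\langle a_i,x\rangle\le b_i$ for all $i\in[m]$. Consider the following algorithm, using an $(\alpha/2,\gamma)$-dual oracle: put $\eta=\frac{\alpha}{4\rho}$, $T=\frac{16\rho^2\log r}{\alpha^2}$, $x^1=e/r$; for $t=1,\dots,T$ let $p^t\in[m]$ be the oracle's answer on $(A,b,x^t)$, let $\ell^t=\frac1\rho a_{p^t}$, and let $$x^{t+1}=\frac{\exp\left(-\eta\sum_{i=1}^t\ell^i\right)}{\mathrm{Tr}\left(\exp\left(-\eta\sum_{i=1}^t\ell^i\right)\right)};$$ return $\overline{x}=\frac1T\sum_{t=1}^Tx^t$. Then $\overline{x}\in\mathcal{K}$ and, with probability at least $1-T\gamma$, $$\langle a_i,\overline{x}\rangle\le b_i+\alpha\qquad\forall i\in[m].$$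
   Context: A Euclidean Jordan algebra (EJA) is a finite-dimensional real vector space $\mathcal{J}$ with a commutative bilinear product $\circ$ satisfying $x^2\circ(x\circ y)=x\circ(x^2\circ y)$ (where $x^2=x\circ x$), an identity element $e$, and an inner product with $\langle x\circ y,z\rangle=\langle x,y\circ z\rangle$. A Jordan frame is a set $\{q_1,\dots,q_r\}$ of primitive idempotents with $q_i\circ q_j=0$ for $i\ne j$ and $\sum_i q_i=e$. Every $x\in\mathcal{J}$ has a spectral decomposition $x=\sum_{i=1}^r\lambda_i(x)q_i$ for some Jordan frame; $r$ is the rank of $\mathcal{J}$. $\mathrm{Tr}(x)=\sum_i\lambda_i(x)$, $\exp(x)=\sum_ie^{\lambda_i(x)}q_i$, $\langle x,y\rangle=\mathrm{Tr}(x\circ y)$, $\|x\|_\infty=\max_i|\lambda_i(x)|$. The cone of squares is $\mathcal{K}=\{x\circ x:x\in\mathcal{J}\}$. Dual oracle: for $\gamma>0$, an $(\alpha_0,\gamma)$-dual oracle, given $A=\{a_1,\dots,a_m\}\in\mathcal{J}^m$, $b\in\mathbb{R}^m$ and $x\in\mathcal{K}$, returns an index $i\in[m]$ such that $\langle a_i,x\rangle-b_i\ge\max_{j\in[m]}(\langle a_j,x\rangle-b_j)-\alpha_0$ with probability at least $1-\gamma$, provided that $\max_{j\in[m]}(\langle a_j,x\rangle-b_j)\ge0$.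
   Formalization: T = 16ρ² log r/α² need not be an integer, and the algorithm is undefined if r = 1 or ρ = 0; here T is this number rounded up and at least 1 (also in the bound 1 − Tγ), and for ρ = 0 the output is e/r. *)

theory Defs
  imports "HOL-Probability.Probability"
begin

(* The inner product of euclidean_space is the associative one required by the definition of a
   Euclidean Jordan algebra; the trace inner product is jinner below. Linearity in the second
   argument and the right unit law follow from commutativity. *)
class euclidean_jordan_algebra = euclidean_space +
  fixes jprod :: "'a \<Rightarrow> 'a \<Rightarrow> 'a" (infixl \<open>\<odot>\<close> 70)
    and junit :: 'a
  assumes jprod_commute: "x \<odot> y = y \<odot> x"
    and jprod_add_left: "(x + y) \<odot> z = x \<odot> z + y \<odot> z"
    and jprod_scaleR_left: "(c *\<^sub>R x) \<odot> y = c *\<^sub>R (x \<odot> y)"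
    and jordan_identity: "(x \<odot> x) \<odot> (x \<odot> y) = x \<odot> ((x \<odot> x) \<odot> y)"
    and jprod_unit: "junit \<odot> x = x"
    and jprod_inner_assoc: "inner (x \<odot> y) z = inner x (y \<odot> z)"

definition idempotent :: "'a::euclidean_jordan_algebra \<Rightarrow> bool" where
  "idempotent c \<longleftrightarrow> c \<odot> c = c"

definition primitive_idempotent :: "'a::euclidean_jordan_algebra \<Rightarrow> bool" where
  "primitive_idempotent c \<longleftrightarrow> idempotent c \<and> c \<noteq> 0 \<and>
     \<not> (\<exists>u v. idempotent u \<and> u \<noteq> 0 \<and> idempotent v \<and> v \<noteq> 0 \<and> c = u + v)"

definition jordan_frame :: "'a::euclidean_jordan_algebra set \<Rightarrow> bool" where
  "jordan_frame Q \<longleftrightarrow> finite Q \<and> (\<forall>q\<in>Q. primitive_idempotent q) \<and>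
     (\<forall>p\<in>Q. \<forall>q\<in>Q. p \<noteq> q \<longrightarrow> p \<odot> q = 0) \<and> \<Sum>Q = junit"

(* All Jordan frames have the same number of elements. *)
definition jrank :: "'a::euclidean_jordan_algebra itself \<Rightarrow> nat" where
  "jrank _ = (THE r. \<forall>Q :: 'a set. jordan_frame Q \<longrightarrow> card Q = r)"

(* A fixed spectral decomposition of x. Frame and eigenvalue labelling are not unique, but the
   functions of x defined from them below do not depend on the choice. *)
definition spectral_frame :: "'a::euclidean_jordan_algebra \<Rightarrow> 'a set" where
  "spectral_frame x = (SOME Q. jordan_frame Q \<and> (\<exists>l. x = (\<Sum>q\<in>Q. l q *\<^sub>R q)))"

(* eigval x q is the eigenvalue of x at the frame element q; it is only meaningful for
   q in spectral_frame x. *)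
definition eigval :: "'a::euclidean_jordan_algebra \<Rightarrow> 'a \<Rightarrow> real" where
  "eigval x = (SOME l. x = (\<Sum>q\<in>spectral_frame x. l q *\<^sub>R q))"

definition jtrace :: "'a::euclidean_jordan_algebra \<Rightarrow> real" where
  "jtrace x = (\<Sum>q\<in>spectral_frame x. eigval x q)"

definition jexp :: "'a::euclidean_jordan_algebra \<Rightarrow> 'a" where
  "jexp x = (\<Sum>q\<in>spectral_frame x. exp (eigval x q) *\<^sub>R q)"

definition jnorm_inf :: "'a::euclidean_jordan_algebra \<Rightarrow> real" where
  "jnorm_inf x = (MAX q\<in>spectral_frame x. \<bar>eigval x q\<bar>)"

definition jinner :: "'a::euclidean_jordan_algebra \<Rightarrow> 'a \<Rightarrow> real" where
  "jinner x y = jtrace (x \<odot> y)"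

definition cone_of_squares :: "'a::euclidean_jordan_algebra set" where
  "cone_of_squares = range (\<lambda>x. x \<odot> x)"

(* The index set [m] is the finite type 'm. D A b x is the law of the index returned on the
   input (A, b, x); nothing is required of it when the maximum is negative. *)
definition dual_oracle ::
  "real \<Rightarrow> real \<Rightarrow>
    ('a::euclidean_jordan_algebra ^ 'm::finite \<Rightarrow> real ^ 'm \<Rightarrow> 'a \<Rightarrow> 'm pmf) \<Rightarrow> bool" where
  "dual_oracle \<alpha>0 \<gamma> D \<longleftrightarrow>
     (\<forall>A b x. x \<in> cone_of_squares \<and> (MAX j. jinner (A $ j) x - b $ j) \<ge> 0 \<longrightarrow>
        measure_pmf.prob (D A b x)
          {i. jinner (A $ i) x - b $ i \<ge> (MAX j. jinner (A $ j) x - b $ j) - \<alpha>0} \<ge> 1 - \<gamma>)"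

definition width :: "'a::euclidean_jordan_algebra ^ 'm::finite \<Rightarrow> real" where
  "width A = (MAX i. jnorm_inf (A $ i))"

definition step_size :: "real \<Rightarrow> 'a::euclidean_jordan_algebra ^ 'm::finite \<Rightarrow> real" where
  "step_size \<alpha> A = \<alpha> / (4 * width A)"

(* The number of rounds is rounded up to an integer. At least one round is made, so that the
   average over the rounds also exists when the formula gives 0 (rank 1 or width 0). In these
   cases only the initial point is used, so the value of step_size for width 0 is irrelevant. *)
definition num_rounds :: "real \<Rightarrow> 'a::euclidean_jordan_algebra ^ 'm::finite \<Rightarrow> nat" where
  "num_rounds \<alpha> A =
     max 1 (nat \<lceil>16 * (width A)\<^sup>2 * ln (real (jrank TYPE('a))) / \<alpha>\<^sup>2\<rceil>)"

(* The iterate x^(t+1) determined by the list ps of the first t answers. *)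
definition mwu_iterate ::
  "real \<Rightarrow> 'a::euclidean_jordan_algebra ^ 'm::finite \<Rightarrow> 'm list \<Rightarrow> 'a" where
  "mwu_iterate \<alpha> A ps =
     (if ps = [] then (1 / real (jrank TYPE('a))) *\<^sub>R junit
      else let y = jexp (- (step_size \<alpha> A *\<^sub>R (\<Sum>p\<leftarrow>ps. (1 / width A) *\<^sub>R A $ p)))
           in (1 / jtrace y) *\<^sub>R y)"

(* The joint law of the first t answers, each call using fresh randomness. *)
primrec mwu_answers ::
  "('a::euclidean_jordan_algebra ^ 'm::finite \<Rightarrow> real ^ 'm \<Rightarrow> 'a \<Rightarrow> 'm pmf) \<Rightarrow>
    real \<Rightarrow> 'a ^ 'm \<Rightarrow> real ^ 'm \<Rightarrow> nat \<Rightarrow> 'm list pmf" where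
  "mwu_answers D \<alpha> A b 0 = return_pmf []"
| "mwu_answers D \<alpha> A b (Suc t) =
     bind_pmf (mwu_answers D \<alpha> A b t)
       (\<lambda>ps. map_pmf (\<lambda>p. ps @ [p]) (D A b (mwu_iterate \<alpha> A ps)))"

definition mwu_output ::
  "('a::euclidean_jordan_algebra ^ 'm::finite \<Rightarrow> real ^ 'm \<Rightarrow> 'a \<Rightarrow> 'm pmf) \<Rightarrow>
    real \<Rightarrow> 'a ^ 'm \<Rightarrow> real ^ 'm \<Rightarrow> 'a pmf" where
  "mwu_output D \<alpha> A b =
     (let T = num_rounds \<alpha> A
      in map_pmf (\<lambda>ps. (1 / real T) *\<^sub>R (\<Sum>t<T. mwu_iterate \<alpha> A (take t ps)))
           (mwu_answers D \<alpha> A b T))"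

end

theory Submission
  imports Defs
begin

text \<open>
The proof is the regret analysis of the matrix multiplicative weights method, in a form that uses only
the spectral theorem of the algebra and the positivity of \<open>Tr (p \<circ> q)\<close> for idempotents \<open>p\<close>, \<open>q\<close>.

Put \<open>\<Phi> y = ln (Tr (exp y))\<close>. The iterates are the Gibbs states \<open>x = exp y / Tr (exp y)\<close>, the gradients of
\<open>\<Phi>\<close>. Two inequalities carry the analysis. The first is convexity, \<open>\<Phi> (y + h) \<ge> \<Phi> y + \<langle>x, h\<rangle>\<close>
(\<open>log_partition_convex\<close>), together with \<open>\<Phi> y \<ge> \<langle>z, y\<rangle>\<close> for all \<open>z\<close> in the cone with trace 1
(\<open>log_partition_ge\<close>). The second is smoothness, \<open>\<Phi> (y + h) \<le> \<Phi> y + \<langle>x, h\<rangle> + M\<^sup>2\<close> if the eigenvalues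
of \<open>h\<close> are at most \<open>M\<close> in absolute value (\<open>log_partition_smooth\<close>). The usual route to such a bound is the
Golden-Thompson inequality. It is replaced here by the bound of the relative entropy of two Gibbs states
\<open>x'\<close>, \<open>x\<close> by their Hellinger distance: with \<open>a\<close>, \<open>a'\<close> the square roots of \<open>x\<close>, \<open>x'\<close>, the relative entropy
is at least \<open>\<parallel>a' - a\<parallel>\<^sup>2\<close>, while \<open>\<langle>x' - x, h\<rangle> = \<langle>(a' - a) \<circ> (a' + a), h\<rangle>\<close> is at most
\<open>\<parallel>a' - a\<parallel>\<^sup>2 + M\<^sup>2\<close>. Convexity and the entropy bound are inequalities between sums of products
\<open>f(s) g(t)\<close> of scalar functions, and such inequalities lift to the algebra because two Jordan frames have
a nonnegative matrix of weights \<open>Tr (p \<circ> q)\<close> (\<open>jinner_jfun_nonneg\<close>).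

All this needs a trace that is linear and associative. Linearity follows from a property of the given
inner product: two primitive idempotents that are not orthogonal have the same norm
(\<open>primitive_nonorthogonal_norm_eq\<close>). Hence the sum of \<open>q / \<parallel>q\<parallel>\<^sup>2\<close> over any Jordan frame has inner product 1
with every primitive idempotent, and represents the trace. It is the same vector for every frame, so it
operator-commutes with every element, and the trace form is associative.

In the algorithm, the oracle promises nothing at a point \<open>x\<close> that satisfies all constraints strictly, and
its answer there may drive the iterates far away from the feasible point of the hypothesis. But then \<open>x\<close>
itself is a feasible point. The potential \<open>\<Phi> y - \<langle>z, y\<rangle> + E\<close>, which measures the divergence of the iterate
from a feasible comparator \<open>z\<close>, is therefore restarted in such a round with \<open>z = x\<close>, where it is 0
(\<open>mwu_potential\<close>). Each other round lowers the potential, scaled by \<open>4\<rho>\<^sup>2 / \<alpha>\<close>, by the maximal violation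
up to an error \<open>3\<alpha>/4\<close>, and the scaled initial value \<open>4\<rho>\<^sup>2 ln r / \<alpha>\<close> is at most \<open>T\<alpha>/4\<close> by the choice of \<open>T\<close>. The oracle
fails in some round with probability at most \<open>T\<gamma>\<close>.
\<close>

section \<open>The Jordan identity and powers\<close>

lemma jprod_add_right: "x \<odot> (y + z) = x \<odot> y + x \<odot> (z::'a::euclidean_jordan_algebra)"
  by (metis jprod_add_left jprod_commute)

lemma jprod_scaleR_right: "x \<odot> (c *\<^sub>R y) = c *\<^sub>R (x \<odot> (y::'a::euclidean_jordan_algebra))"
  by (metis jprod_scaleR_left jprod_commute)

lemma bilinear_jprod: "bilinear ((\<odot>) :: 'a \<Rightarrow> 'a \<Rightarrow> 'a::euclidean_jordan_algebra)"
  by (auto simp: bilinear_def linear_iff jprod_add_left jprod_add_right jprod_scaleR_left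
      jprod_scaleR_right)

lemma linear_jprod: "linear ((\<odot>) (x::'a::euclidean_jordan_algebra))"
  using bilinear_jprod by (auto simp: bilinear_def)

lemmas jprod_zero_right = linear_0[OF linear_jprod]
lemmas jprod_diff_right = linear_diff[OF linear_jprod]
lemmas jprod_minus_right = linear_neg[OF linear_jprod]
lemmas jprod_sum_right = linear_sum[OF linear_jprod]
lemmas jprod_zero_left = bilinear_lzero[OF bilinear_jprod]
lemmas jprod_diff_left = bilinear_lsub[OF bilinear_jprod]
lemmas jprod_minus_left = bilinear_lneg[OF bilinear_jprod]

lemma jprod_sum_left: "sum f S \<odot> x = (\<Sum>i\<in>S. f i \<odot> (x::'a::euclidean_jordan_algebra))"
  by (simp add: jprod_commute[of _ x] jprod_sum_right)

lemma jprod_unit_right: "x \<odot> junit = (x::'a::euclidean_jordan_algebra)"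
  by (metis jprod_unit jprod_commute)

lemmas jprod_linear = jprod_add_left jprod_add_right jprod_scaleR_left jprod_scaleR_right
  jprod_zero_left jprod_zero_right jprod_diff_left jprod_diff_right jprod_minus_left
  jprod_minus_right

lemma junit_nonzero: "(junit::'a::euclidean_jordan_algebra) \<noteq> 0"
proof
  assume "(junit::'a) = 0"
  then have "x = 0" for x :: 'a
    using jprod_unit[of x] jprod_zero_left[of x] by simp
  moreover obtain b :: 'a where "b \<in> Basis" by (meson ex_in_conv nonempty_Basis)
  ultimately show False using nonzero_Basis[of b] by simp
qed

lemma jprod_left_commute_inner: "inner (x \<odot> y) z = inner y (x \<odot> (z::'a::euclidean_jordan_algebra))"
  by (metis jprod_commute jprod_inner_assoc)

text \<open>The identity at \<open>a + b\<close> minus the identity at \<open>a - b\<close>, minus twice the identity at \<open>b\<close>, is twice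
the part that is quadratic in \<open>a\<close> and linear in \<open>b\<close>.\<close>

lemma jordan_linearized_twice:
  fixes a b y :: "'a::euclidean_jordan_algebra"
  shows "2 *\<^sub>R (a \<odot> ((a \<odot> b) \<odot> y)) + b \<odot> ((a \<odot> a) \<odot> y)
       = 2 *\<^sub>R ((a \<odot> b) \<odot> (a \<odot> y)) + (a \<odot> a) \<odot> (b \<odot> y)"
proof (rule vector_eq_ldot[THEN iffD1], rule allI)
  fix w
  have e: "inner w (((a + b) \<odot> (a + b)) \<odot> ((a + b) \<odot> y)) = inner w ((a + b) \<odot> (((a + b) \<odot> (a + b)) \<odot> y))"
    "inner w (((a - b) \<odot> (a - b)) \<odot> ((a - b) \<odot> y)) = inner w ((a - b) \<odot> (((a - b) \<odot> (a - b)) \<odot> y))"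
    "inner w ((b \<odot> b) \<odot> (b \<odot> y)) = inner w (b \<odot> ((b \<odot> b) \<odot> y))"
    by (simp_all only: jordan_identity)
  show "inner w (2 *\<^sub>R (a \<odot> ((a \<odot> b) \<odot> y)) + b \<odot> ((a \<odot> a) \<odot> y))
       = inner w (2 *\<^sub>R ((a \<odot> b) \<odot> (a \<odot> y)) + (a \<odot> a) \<odot> (b \<odot> y))"
    using e unfolding jprod_linear inner_simps jprod_commute[of b a] by linarith
qed

lemma jordan_linearized:
  fixes a b c y :: "'a::euclidean_jordan_algebra"
  shows "a \<odot> ((b \<odot> c) \<odot> y) + b \<odot> ((c \<odot> a) \<odot> y) + c \<odot> ((a \<odot> b) \<odot> y)
       = (b \<odot> c) \<odot> (a \<odot> y) + (c \<odot> a) \<odot> (b \<odot> y) + (a \<odot> b) \<odot> (c \<odot> y)"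
proof (rule vector_eq_ldot[THEN iffD1], rule allI)
  fix w
  note t = arg_cong[OF jordan_linearized_twice, of "inner w"]
  show "inner w (a \<odot> ((b \<odot> c) \<odot> y) + b \<odot> ((c \<odot> a) \<odot> y) + c \<odot> ((a \<odot> b) \<odot> y))
       = inner w ((b \<odot> c) \<odot> (a \<odot> y) + (c \<odot> a) \<odot> (b \<odot> y) + (a \<odot> b) \<odot> (c \<odot> y))"
    using t[of "a + c" b y] t[of a b y] t[of c b y]
    unfolding jprod_linear inner_simps jprod_commute[of c a] jprod_commute[of c b] by algebra
qed

text \<open>Operator commutativity: the multiplications by \<open>u\<close> and \<open>v\<close> commute. It takes the place of
associativity in the arguments below.\<close>

definition jcommute :: "'a::euclidean_jordan_algebra \<Rightarrow> 'a \<Rightarrow> bool" where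
  "jcommute u v \<longleftrightarrow> (\<forall>z. u \<odot> (v \<odot> z) = v \<odot> (u \<odot> z))"

lemma jcommute_sym: "jcommute u v \<Longrightarrow> jcommute v u"
  by (simp add: jcommute_def)

lemma jcommuteD: "jcommute u v \<Longrightarrow> u \<odot> (v \<odot> z) = v \<odot> (u \<odot> z)"
  by (simp add: jcommute_def)

lemma jcommute_refl: "jcommute u u"
  by (simp add: jcommute_def)

lemma subspace_jcommute: "subspace {v. jcommute u v}"
  by (auto simp: subspace_def jcommute_def jprod_linear)

lemma jcommute_span:
  assumes "\<And>u v. u \<in> S \<Longrightarrow> v \<in> T \<Longrightarrow> jcommute u v" "u \<in> span S" "v \<in> span T"
  shows "jcommute u v"
proof -
  have "jcommute s v" if "s \<in> S" for s
    using span_minimal[OF _ subspace_jcommute[of s], of T] assms that by auto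
  then show ?thesis
    using span_minimal[OF _ subspace_jcommute[of v], of S] assms jcommute_sym by blast
qed

lemma jcommute_peirce_one:
  assumes "idempotent c" "c \<odot> x = x"
  shows "jcommute c x"
  unfolding jcommute_def
proof (intro allI, rule vector_eq_ldot[THEN iffD1], rule allI)
  fix z w
  show "inner w (c \<odot> (x \<odot> z)) = inner w (x \<odot> (c \<odot> z))"
    using arg_cong[OF jordan_linearized_twice[of c x z], of "inner w"] assms
    by (simp add: idempotent_def inner_simps)
qed

lemma jcommute_peirce_zero:
  assumes "idempotent c" "c \<odot> x = 0"
  shows "jcommute c x"
  using jordan_linearized_twice[of c x] assms
  by (simp add: idempotent_def jcommute_def jprod_linear)

text \<open>The linearized identity, read as an identity between operators applied to \<open>u\<close>: the
multiplication by \<open>(y \<odot> z) \<odot> w\<close> is a polynomial in the multiplications by products of at most two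
factors.\<close>

lemma jprod_triple:
  fixes y :: "'a::euclidean_jordan_algebra"
  shows "((y \<odot> z) \<odot> w) \<odot> u = (y \<odot> z) \<odot> (w \<odot> u) + (y \<odot> w) \<odot> (z \<odot> u) + (z \<odot> w) \<odot> (y \<odot> u)
     - y \<odot> (w \<odot> (z \<odot> u)) - z \<odot> (w \<odot> (y \<odot> u))"
proof -
  have "u \<odot> ((y \<odot> z) \<odot> w) + y \<odot> (w \<odot> (z \<odot> u)) + z \<odot> (w \<odot> (y \<odot> u))
    = (y \<odot> z) \<odot> (w \<odot> u) + (y \<odot> w) \<odot> (z \<odot> u) + (z \<odot> w) \<odot> (y \<odot> u)"
    using jordan_linearized[of u y z w]
    by (simp add: jprod_commute[of u y] jprod_commute[of w] jprod_commute[of _ "y \<odot> w"]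
       jprod_commute[of _ "z \<odot> w"] add.assoc)
  then show ?thesis
    by (simp add: jprod_commute[of u] algebra_simps)
qed

text \<open>The recursion starts from an idempotent \<open>c\<close> with \<open>c \<odot> x = x\<close> instead of the unit. So the same
powers serve the whole algebra (\<open>c\<close> the unit) and the Peirce space of \<open>c\<close>.\<close>

primrec jpow :: "'a::euclidean_jordan_algebra \<Rightarrow> 'a \<Rightarrow> nat \<Rightarrow> 'a" where
  "jpow c x 0 = c"
| "jpow c x (Suc n) = x \<odot> jpow c x n"

text \<open>By \<open>jprod_triple\<close>, multiplication by a power is a polynomial in the multiplications by
\<open>c\<close>, \<open>x\<close> and \<open>x \<odot> x\<close>.\<close>

lemma jcommute_jpow:
  assumes c: "c \<odot> x = x" and u: "jcommute u c" "jcommute u x" "jcommute u (x \<odot> x)"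
  shows "jcommute u (jpow c x n)"
proof (induction n rule: less_induct)
  case (less n)
  show ?case
  proof (cases "n < 2")
    case True
    then have "n = 0 \<or> n = 1" by auto
    then show ?thesis using u c by (auto simp: jprod_commute[of x c])
  next
    case False
    then obtain k where n: "n = Suc (Suc k)"
      by (metis add_2_eq_Suc le_Suc_ex not_less)
    let ?P = "jpow c x k"
    have h: "jcommute u ?P" "jcommute u (x \<odot> ?P)"
      using less.IH[of k] less.IH[of "Suc k"] n by auto
    have "jpow c x n \<odot> z = 2 *\<^sub>R ((x \<odot> ?P) \<odot> (x \<odot> z)) + (x \<odot> x) \<odot> (?P \<odot> z)
       - ?P \<odot> (x \<odot> (x \<odot> z)) - x \<odot> (x \<odot> (?P \<odot> z))" for z
      using jprod_triple[of ?P x x z] unfolding n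
      by (simp add: jprod_commute[of ?P x] jprod_commute[of "x \<odot> ?P" x] scaleR_2)
    then show ?thesis
      by (simp add: jcommute_def jprod_linear u[THEN jcommuteD] h[THEN jcommuteD])
  qed
qed

lemma
  assumes c: "idempotent c" "c \<odot> x = x"
  shows jcommute_jpow_jpow: "jcommute (jpow c x m) (jpow c x n)"
    and jpow_unit: "c \<odot> jpow c x n = jpow c x n"
    and jpow_add: "jpow c x m \<odot> jpow c x n = jpow c x (m + n)"
proof -
  have cx: "jcommute c x" using c by (rule jcommute_peirce_one)
  have "c \<odot> (x \<odot> x) = x \<odot> x" using jcommuteD[OF cx] c by simp
  then have cxx: "jcommute c (x \<odot> x)" using c jcommute_peirce_one by blast
  have xxx: "jcommute x (x \<odot> x)" by (simp add: jcommute_def jordan_identity)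
  have "jcommute c (jpow c x m)" "jcommute x (jpow c x m)" "jcommute (x \<odot> x) (jpow c x m)" for m
    using c cx cxx xxx by (auto intro!: jcommute_jpow intro: jcommute_refl jcommute_sym)
  then show comm: "jcommute (jpow c x m) (jpow c x n)" for m n
    using c by (metis jcommute_jpow jcommute_sym)
  show unit: "c \<odot> jpow c x n = jpow c x n" for n
    using c by (induction n) (auto simp: idempotent_def jcommuteD[OF cx])
  show "jpow c x m \<odot> jpow c x n = jpow c x (m + n)"
  proof (induction m)
    case 0
    then show ?case by (simp add: unit)
  next
    case (Suc m)
    have "jcommute (jpow c x n) x" using comm[of n 1] c by (simp add: jprod_commute[of x c])
    then show ?case
      using Suc jcommuteD[of "jpow c x n" x "jpow c x m"]
      by (simp add: jprod_commute[of _ "jpow c x n"])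
  qed
qed

section \<open>Idempotents and the spectral theorem\<close>

lemma inner_idempotent_left: "idempotent c \<Longrightarrow> inner c x = inner c (c \<odot> x)"
  by (metis idempotent_def jprod_inner_assoc)

definition orthogonal_idempotents :: "'a::euclidean_jordan_algebra set \<Rightarrow> bool" where
  "orthogonal_idempotents Q \<longleftrightarrow> finite Q \<and> (\<forall>q\<in>Q. idempotent q \<and> q \<noteq> 0) \<and>
     (\<forall>p\<in>Q. \<forall>q\<in>Q. p \<noteq> q \<longrightarrow> p \<odot> q = 0)"

lemma jordan_frame_iff:
  "jordan_frame Q \<longleftrightarrow>
     orthogonal_idempotents Q \<and> \<Sum>Q = junit \<and> (\<forall>q\<in>Q. primitive_idempotent q)"
  unfolding jordan_frame_def orthogonal_idempotents_def primitive_idempotent_def by blast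

lemma independent_orthogonal_idempotents:
  assumes "orthogonal_idempotents Q"
  shows "independent Q"
proof (rule pairwise_orthogonal_independent)
  show "pairwise orthogonal Q"
    using assms inner_idempotent_left
    unfolding pairwise_def orthogonal_idempotents_def orthogonal_def
    by (metis inner_zero_right)
  show "0 \<notin> Q" using assms by (auto simp: orthogonal_idempotents_def)
qed

lemma card_orthogonal_idempotents:
  "orthogonal_idempotents (Q :: 'a::euclidean_jordan_algebra set) \<Longrightarrow> card Q \<le> DIM('a)"
  using independent_bound independent_orthogonal_idempotents by blast

lemma jprod_sum_orthogonal_idempotents:
  assumes "orthogonal_idempotents Q" "p \<in> Q"
  shows "p \<odot> (\<Sum>q\<in>Q. l q *\<^sub>R q) = l p *\<^sub>R p"
proof -
  have "p \<odot> (\<Sum>q\<in>Q. l q *\<^sub>R q) = (\<Sum>q\<in>Q. if q = p then l p *\<^sub>R p else 0)"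
    unfolding jprod_sum_right using assms
    by (intro sum.cong) (auto simp: orthogonal_idempotents_def idempotent_def jprod_linear)
  then show ?thesis using assms by (simp add: orthogonal_idempotents_def)
qed

lemma orthogonal_summands:
  assumes "idempotent (u + v)" "idempotent u" "idempotent v"
  shows "u \<odot> v = 0"
proof -
  have "2 *\<^sub>R (u \<odot> v) = 0"
    using assms by (simp add: idempotent_def jprod_linear jprod_commute[of v u] scaleR_2)
  then show ?thesis by simp
qed

text \<open>Both elements operator-commute with \<open>c\<close>, so their product lies in the eigenspaces of
\<open>c\<close> for 1 and for 0.\<close>

lemma peirce_one_zero_orthogonal:
  assumes "idempotent c" "c \<odot> x = x" "c \<odot> y = 0"
  shows "x \<odot> y = 0"
  using jcommuteD[OF jcommute_peirce_one[OF assms(1,2)], of y]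
    jcommuteD[OF jcommute_peirce_zero[OF assms(1,3)], of x] assms
  by (metis jprod_commute jprod_zero_right)

text \<open>Systems of orthogonal idempotents of maximal cardinality exist, because such systems are linearly
independent. This refinement step shows that the members of a maximal system cannot be split.\<close>

lemma orthogonal_idempotents_split:
  assumes Q: "orthogonal_idempotents Q" "u + v \<in> Q"
    and uv: "idempotent u" "u \<noteq> 0" "idempotent v" "v \<noteq> 0"
  defines "Q' \<equiv> insert u (insert v (Q - {u + v}))"
  shows "orthogonal_idempotents Q'" "\<Sum>Q' = \<Sum>Q" "card Q' = Suc (card Q)" "Q \<subseteq> span Q'"
proof -
  let ?q = "u + v"
  have q: "idempotent ?q" using Q by (auto simp: orthogonal_idempotents_def)
  have o: "u \<odot> v = 0" using orthogonal_summands[OF q] uv by blast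
  then have o': "v \<odot> u = 0" by (simp add: jprod_commute)
  have one: "?q \<odot> u = u" "?q \<odot> v = v"
    using uv o o' by (simp_all add: idempotent_def jprod_linear)
  have zero: "u \<odot> p = 0" "v \<odot> p = 0" "p \<odot> u = 0" "p \<odot> v = 0" if "p \<in> Q - {?q}" for p
  proof -
    have "?q \<odot> p = 0" using Q that by (auto simp: orthogonal_idempotents_def)
    then show "u \<odot> p = 0" "v \<odot> p = 0"
      using peirce_one_zero_orthogonal[OF q] one by blast+
    then show "p \<odot> u = 0" "p \<odot> v = 0" by (simp_all add: jprod_commute)
  qed
  have fin: "finite Q" using Q by (simp add: orthogonal_idempotents_def)
  have new: "u \<notin> Q - {?q}" "v \<notin> Q - {?q}" "u \<noteq> v"
    using zero uv o unfolding idempotent_def by metis+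
  show "orthogonal_idempotents Q'"
    using Q uv o o' zero unfolding orthogonal_idempotents_def Q'_def by auto
  show "\<Sum>Q' = \<Sum>Q"
    using new fin Q(2) by (simp add: Q'_def sum.remove[of Q ?q "\<lambda>x. x"] add.assoc)
  show "card Q' = Suc (card Q)"
    using new fin Q(2) card.remove[of Q ?q] by (simp add: Q'_def)
  have "?q \<in> span Q'" by (intro span_add span_base) (auto simp: Q'_def)
  then show "Q \<subseteq> span Q'" using span_superset[of Q'] unfolding Q'_def by blast
qed

text \<open>Commuting multiplications and the commutativity of the product make such a subalgebra
associative.\<close>

definition commutative_subalgebra :: "'a::euclidean_jordan_algebra set \<Rightarrow> bool" where
  "commutative_subalgebra W \<longleftrightarrow> subspace W \<and> (\<forall>u\<in>W. \<forall>v\<in>W. u \<odot> v \<in> W \<and> jcommute u v)"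

text \<open>The maximum of the Rayleigh quotient on the unit sphere of an invariant subspace is an
eigenvalue.\<close>

lemma rayleigh_eigenvector:
  fixes g :: "'a::euclidean_space \<Rightarrow> 'a"
  assumes S: "subspace S" and g: "linear g" "\<And>u. u \<in> S \<Longrightarrow> g u \<in> S"
    and sym: "\<And>u v. u \<in> S \<Longrightarrow> v \<in> S \<Longrightarrow> inner (g u) v = inner u (g v)"
    and z: "z \<in> S" "z \<noteq> 0"
  obtains l u where "u \<in> S" "u \<noteq> 0" "g u = l *\<^sub>R u"
proof -
  let ?K = "S \<inter> sphere 0 1"
  have "compact ?K" using closed_subspace[OF S] by (simp add: closed_Int_compact)
  moreover have "(1 / norm z) *\<^sub>R z \<in> ?K" using z S by (simp add: subspace_scale)
  moreover have "continuous_on ?K (\<lambda>u. inner (g u) u)"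
    by (intro continuous_intros linear_continuous_on linear_conv_bounded_linear[THEN iffD1] g)
  ultimately obtain u where u: "u \<in> ?K" and max: "\<And>v. v \<in> ?K \<Longrightarrow> inner (g v) v \<le> inner (g u) u"
    using continuous_attains_sup[of ?K "\<lambda>u. inner (g u) u"] by blast
  define l where "l = inner (g u) u"
  define h where "h v = l *\<^sub>R v - g v" for v
  have lh: "linear h" unfolding h_def
    by (intro linear_compose_sub g linear_compose_scale_right linear_ident)
  have hS: "h v \<in> S" if "v \<in> S" for v
    using that S g by (simp add: h_def subspace_diff subspace_scale)
  have hpos: "0 \<le> inner (h v) v" if v: "v \<in> S" for v
  proof (cases "v = 0")
    case False
    have "(1 / norm v) *\<^sub>R v \<in> ?K" using v S False by (simp add: subspace_scale)
    then have "inner (g ((1 / norm v) *\<^sub>R v)) ((1 / norm v) *\<^sub>R v) \<le> l"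
      unfolding l_def by (rule max)
    then have "inner (g v) v \<le> l * (norm v)\<^sup>2"
      using False by (simp add: linear_cmul[OF g(1)] field_simps power2_eq_square)
    then show ?thesis by (simp add: h_def inner_diff_left power2_norm_eq_inner)
  qed simp
  have hu0: "inner (h u) u = 0"
    using u by (simp add: h_def inner_diff_left l_def power2_norm_eq_inner[symmetric])
  have uS: "u \<in> S" using u by simp
  have "h u = 0"
  proof (rule ccontr)
    assume "h u \<noteq> 0"
    define w where "w = h u"
    have wS: "w \<in> S" by (simp add: w_def hS uS)
    have hsym: "inner (h w) u = inner w w"
      using sym[OF wS uS] by (simp add: w_def h_def[of "h u"] inner_diff_left)
        (simp add: h_def inner_diff_right w_def)
    \<comment> \<open>The form of \<open>h\<close> at \<open>u - t w\<close> is \<open>- 2 t (w, w) + t\<^sup>2 (h w, w)\<close>, negative for small positive \<open>t\<close>.\<close>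
    have key: "0 \<le> - 2 * t * inner w w + t\<^sup>2 * inner (h w) w" for t
    proof -
      have "0 \<le> inner (h (u - t *\<^sub>R w)) (u - t *\<^sub>R w)"
        by (intro hpos subspace_diff subspace_scale S uS wS)
      also have "\<dots> = inner (h u) u - t * inner (h w) u - t * inner (h u) w + t\<^sup>2 * inner (h w) w"
        by (simp add: linear_diff[OF lh] linear_cmul[OF lh] inner_simps power2_eq_square algebra_simps)
      finally show ?thesis using hu0 hsym by (simp add: w_def)
    qed
    have ww: "inner w w > 0" using \<open>h u \<noteq> 0\<close> by (simp add: w_def)
    have hw: "inner (h w) w \<ge> 0" by (rule hpos[OF wS])
    define t where "t = inner w w / (inner (h w) w + 1)"
    have t: "t > 0" using ww hw by (simp add: t_def)
    have "t * inner (h w) w \<le> inner w w"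
      using ww hw by (simp add: t_def divide_simps)
    then have "t * (t * inner (h w) w) \<le> t * inner w w" using t by simp
    moreover have "0 < t * inner w w" using t ww by simp
    ultimately show False using key[of t] by (simp add: power2_eq_square algebra_simps)
  qed
  moreover have "u \<noteq> 0" using u by auto
  ultimately show ?thesis using that[of u l] uS by (simp add: h_def)
qed

text \<open>Otherwise multiplication by \<open>w\<close> has an eigenvalue whose eigenspace is a proper ideal, and
the projections of \<open>q\<close> to that ideal and to its orthogonal complement, again an ideal, split \<open>q\<close>.\<close>

lemma commutative_subalgebra_minimal_idempotent:
  assumes W: "commutative_subalgebra W" and q: "q \<in> W" "idempotent q"
    and min: "\<And>u v. u \<in> W \<Longrightarrow> v \<in> W \<Longrightarrow> idempotent u \<Longrightarrow> idempotent v \<Longrightarrow> q = u + v \<Longrightarrow> u = 0 \<or> v = 0"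
    and w: "w \<in> W" "q \<odot> w = w"
  shows "\<exists>l. w = l *\<^sub>R q"
proof (cases "q = 0")
  case True
  then show ?thesis using w by (simp add: jprod_linear)
next
  case False
  have sW: "subspace W" and mW: "\<And>u v. u \<in> W \<Longrightarrow> v \<in> W \<Longrightarrow> u \<odot> v \<in> W"
    and cW: "\<And>u v z. u \<in> W \<Longrightarrow> v \<in> W \<Longrightarrow> u \<odot> (v \<odot> z) = v \<odot> (u \<odot> z)"
    using W by (auto simp: commutative_subalgebra_def jcommute_def)
  define S where "S = {u\<in>W. q \<odot> u = u}"
  have S: "subspace S" using sW by (auto simp: S_def subspace_def jprod_linear)
  have mS: "u \<odot> v \<in> S" if "u \<in> S" "v \<in> S" for u v
    using that mW cW[of q u v] q by (auto simp: S_def)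
  have qS: "q \<in> S" using q by (simp add: S_def idempotent_def)
  have wS: "w \<in> S" using w by (simp add: S_def)
  obtain l u where u: "u \<in> S" "u \<noteq> 0" "w \<odot> u = l *\<^sub>R u"
    by (rule rayleigh_eigenvector[OF S linear_jprod mS[OF wS] _ qS False])
      (auto simp: jprod_left_commute_inner)
  define d where "d = w - l *\<^sub>R q"
  have dS: "d \<in> S" unfolding d_def by (intro subspace_diff subspace_scale S wS qS)
  \<comment> \<open>The annihilator of \<open>d\<close> is an ideal, and projecting \<open>q\<close> to it splits \<open>q\<close> into idempotents.\<close>
  define I where "I = {v\<in>S. d \<odot> v = 0}"
  have I: "subspace I" using S by (auto simp: I_def subspace_def jprod_linear)
  have uI: "u \<in> I" using u by (simp add: I_def d_def jprod_linear) (simp add: S_def)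
  have ideal: "v \<odot> i \<in> I" if "v \<in> S" "i \<in> I" for v i
    using that mS cW[of d v i] dS by (auto simp: I_def S_def jprod_linear)
  obtain a b where a: "a \<in> span I" and b: "\<And>i. i \<in> span I \<Longrightarrow> orthogonal b i" and ab: "q = a + b"
    using orthogonal_subspace_decomp_exists[of I q] by metis
  have aI: "a \<in> I" and bI: "\<And>i. i \<in> I \<Longrightarrow> inner b i = 0"
    using a b I by (auto simp: span_eq_iff[THEN iffD2] orthogonal_def)
  have aS: "a \<in> S" using aI by (simp add: I_def)
  have bS: "b \<in> S" using ab subspace_diff[OF S qS aS] by simp
  have "b \<odot> a \<in> I" using ideal bS aI by blast
  moreover have "inner (b \<odot> a) i = 0" if "i \<in> I" for i
    using bI[OF ideal[OF aS that]] by (simp add: jprod_inner_assoc)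
  ultimately have ba: "b \<odot> a = 0" by (metis inner_eq_zero_iff)
  have qa: "q \<odot> a = a" "q \<odot> b = b" using aS bS by (simp_all add: S_def)
  then have ia: "idempotent a" using ba by (simp add: ab jprod_linear idempotent_def)
  have ib: "idempotent b"
    using qa ba by (simp add: ab jprod_linear idempotent_def jprod_commute[of a b])
  have "a \<noteq> 0"
  proof
    assume "a = 0"
    then have "inner q (u \<odot> u) = 0" using bI[OF ideal[OF u(1) uI]] ab by simp
    then have "inner (q \<odot> u) u = 0" by (simp add: jprod_inner_assoc)
    then show False using u by (simp add: S_def)
  qed
  then have "b = 0" using min[of a b] ia ib ab aS bS by (auto simp: S_def)
  then have "d \<odot> q = 0" using aI ab by (simp add: I_def)
  then have "d = 0" using dS by (simp add: S_def jprod_commute[of d q])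
  then show ?thesis by (auto simp: d_def)
qed

lemma commutative_subalgebra_jpow:
  assumes "idempotent c" "c \<odot> x = x"
  shows "commutative_subalgebra (span (range (jpow c x)))" (is "commutative_subalgebra ?W")
    and "u \<in> span (range (jpow c x)) \<Longrightarrow> c \<odot> u = u"
proof -
  have "jcommute u v" if "u \<in> ?W" "v \<in> ?W" for u v
    using that by (rule jcommute_span[rotated]) (auto intro: jcommute_jpow_jpow[OF assms])
  moreover have "u \<odot> v \<in> ?W" if u: "u \<in> ?W" and v: "v \<in> ?W" for u v
  proof -
    have "{w. jpow c x m \<odot> w \<in> ?W} \<supseteq> ?W" for m
      by (rule span_minimal)
        (auto simp: subspace_def jprod_linear jpow_add[OF assms] intro: span_base span_zero span_add span_scale)
    then have "range (jpow c x) \<subseteq> {w. w \<odot> v \<in> ?W}" using v by auto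
    then have "?W \<subseteq> {w. w \<odot> v \<in> ?W}"
      by (rule span_minimal)
        (auto simp: subspace_def jprod_linear intro: span_base span_zero span_add span_scale)
    then show ?thesis using u by auto
  qed
  ultimately show "commutative_subalgebra ?W"
    by (auto simp: commutative_subalgebra_def)
  have "?W \<subseteq> {u. c \<odot> u = u}"
    by (rule span_minimal) (auto simp: subspace_def jprod_linear jpow_unit[OF assms])
  then show "c \<odot> u = u" if "u \<in> ?W" using that by auto
qed

text \<open>The powers of \<open>x\<close> relative to \<open>q\<close> span a commutative subalgebra in which \<open>q\<close> does not split.\<close>

lemma peirce_one_primitive:
  assumes q: "primitive_idempotent q" and x: "q \<odot> x = x"
  shows "\<exists>l. x = l *\<^sub>R q"
proof -
  define W where "W = span (range (jpow q x))"
  have id: "idempotent q" using q by (simp add: primitive_idempotent_def)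
  have W: "commutative_subalgebra W"
    unfolding W_def by (rule commutative_subalgebra_jpow(1)[OF id x])
  have "jpow q x (Suc 0) = x" using x by (simp add: jprod_commute[of x])
  then have xW: "x \<in> W" unfolding W_def by (metis rangeI span_base)
  have qW: "q \<in> W" unfolding W_def by (metis jpow.simps(1) rangeI span_base)
  have "u = 0 \<or> v = 0" if "idempotent u" "idempotent v" "q = u + v" for u v
    using q that unfolding primitive_idempotent_def by blast
  then show ?thesis
    by (intro commutative_subalgebra_minimal_idempotent[OF W qW id _ xW x])
qed

lemma obtain_max_card:
  assumes "P Q" "\<And>Q. P Q \<Longrightarrow> card Q \<le> (n::nat)"
  obtains Q where "P Q" "\<And>Q'. P Q' \<Longrightarrow> card Q' \<le> card Q"
proof -
  have "\<exists>Q. P Q \<and> (\<forall>Q'. P Q' \<longrightarrow> card Q' \<le> card Q)"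
    by (rule ex_has_greatest_nat[of P Q card "Suc n"]) (use assms in \<open>simp_all add: less_Suc_eq_le\<close>)
  then obtain R where R: "P R" "\<forall>Q'. P Q' \<longrightarrow> card Q' \<le> card R" by (elim exE conjE)
  show ?thesis using R by (intro that[of R]) simp_all
qed

lemma orthogonal_idempotents_decomposition:
  fixes x :: "'a::euclidean_jordan_algebra"
  obtains Q where "orthogonal_idempotents Q" "\<Sum>Q = junit" "x \<in> span Q"
proof -
  define W where "W = span (range (jpow junit x))"
  have unit: "idempotent (junit::'a)" by (simp add: idempotent_def jprod_unit)
  have W: "commutative_subalgebra W" unfolding W_def
    using unit by (intro commutative_subalgebra_jpow(1)) (simp_all add: jprod_unit)
  have inW: "junit \<in> W" "x \<in> W"
    unfolding W_def by (metis jpow.simps jprod_unit_right rangeI span_base)+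
  define P where "P Q \<longleftrightarrow> orthogonal_idempotents Q \<and> Q \<subseteq> W \<and> \<Sum>Q = junit" for Q
  have "P {junit}" using unit inW junit_nonzero by (simp add: P_def orthogonal_idempotents_def)
  moreover have "card Q \<le> DIM('a)" if "P Q" for Q
    using that card_orthogonal_idempotents by (auto simp: P_def)
  ultimately obtain Q where Q: "P Q" and max: "\<And>Q'. P Q' \<Longrightarrow> card Q' \<le> card Q"
    using obtain_max_card[of P "{junit}" "DIM('a)"] by blast
  have "q \<odot> x \<in> span Q" if q: "q \<in> Q" for q
  proof -
    have id: "idempotent q" and qW: "q \<in> W"
      using Q q by (auto simp: P_def orthogonal_idempotents_def)
    have qq: "q \<odot> (q \<odot> x) = q \<odot> x"
      using W qW inW id jcommuteD[of x q q]
      by (metis commutative_subalgebra_def idempotent_def jprod_commute)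
    have "\<exists>l. q \<odot> x = l *\<^sub>R q"
    proof (rule commutative_subalgebra_minimal_idempotent[OF W qW id _ _ qq])
      show "q \<odot> x \<in> W" using W qW inW by (simp add: commutative_subalgebra_def)
      fix u v
      assume uv: "u \<in> W" "v \<in> W" "idempotent u" "idempotent v" "q = u + v"
      show "u = 0 \<or> v = 0"
      proof (rule ccontr)
        assume "\<not> ?thesis"
        then have nz: "u \<noteq> 0" "v \<noteq> 0" by simp_all
        define Q' where "Q' = insert u (insert v (Q - {u + v}))"
        have "orthogonal_idempotents Q" "u + v \<in> Q"
          using Q q uv(5) by (simp_all add: P_def)
        note s = orthogonal_idempotents_split[OF this uv(3) nz(1) uv(4) nz(2), folded Q'_def]
        have "Q' \<subseteq> W" using Q uv(1,2) by (auto simp: P_def Q'_def)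
        then have "P Q'" using s(1,2) Q by (simp add: P_def)
        then show False using max[of Q'] s(3) by simp
      qed
    qed
    then show ?thesis using span_scale[OF span_base[OF q]] by auto
  qed
  then have "(\<Sum>q\<in>Q. q \<odot> x) \<in> span Q" by (rule span_sum)
  then have "x \<in> span Q" using Q by (simp add: P_def jprod_sum_left[symmetric] jprod_unit)
  then show ?thesis using that[of Q] Q by (simp add: P_def)
qed

text \<open>Among the systems of orthogonal idempotents that sum to the unit and span a space containing
\<open>x\<close>, one of maximal cardinality consists of primitive idempotents.\<close>

lemma spectral_theorem:
  fixes x :: "'a::euclidean_jordan_algebra"
  obtains Q l where "jordan_frame Q" "x = (\<Sum>q\<in>Q. l q *\<^sub>R q)"
proof -
  define P where "P Q \<longleftrightarrow> orthogonal_idempotents Q \<and> \<Sum>Q = junit \<and> x \<in> span Q" for Q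
  obtain Q0 where "P Q0"
    using orthogonal_idempotents_decomposition[of x] unfolding P_def by blast
  moreover have "card Q \<le> DIM('a)" if "P Q" for Q
    using that card_orthogonal_idempotents by (auto simp: P_def)
  ultimately obtain Q where Q: "P Q" and max: "\<And>Q'. P Q' \<Longrightarrow> card Q' \<le> card Q"
    using obtain_max_card[of P Q0 "DIM('a)"] by blast
  have "primitive_idempotent q" if q: "q \<in> Q" for q
    unfolding primitive_idempotent_def
  proof (intro conjI notI)
    show "idempotent q" using Q q by (auto simp: P_def orthogonal_idempotents_def)
    show "False" if "q = 0" using Q q that by (auto simp: P_def orthogonal_idempotents_def)
    assume "\<exists>u v. idempotent u \<and> u \<noteq> 0 \<and> idempotent v \<and> v \<noteq> 0 \<and> q = u + v"
    then obtain u v where uv: "idempotent u" "u \<noteq> 0" "idempotent v" "v \<noteq> 0" "q = u + v" by blast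
    define Q' where "Q' = insert u (insert v (Q - {u + v}))"
    have s: "orthogonal_idempotents Q'" "\<Sum>Q' = \<Sum>Q" "card Q' = Suc (card Q)" "Q \<subseteq> span Q'"
      using orthogonal_idempotents_split[of Q u v] Q q uv unfolding P_def Q'_def by blast+
    have "span Q \<subseteq> span Q'" using s(4) by (simp add: span_minimal)
    then have "P Q'" using s Q by (auto simp: P_def)
    then show False using max[of Q'] s by simp
  qed
  then have "jordan_frame Q" using Q by (simp add: P_def jordan_frame_iff)
  moreover have "finite Q" using Q by (simp add: P_def orthogonal_idempotents_def)
  then obtain l where "x = (\<Sum>q\<in>Q. l q *\<^sub>R q)"
    using Q span_finite[of Q] by (auto simp: P_def)
  ultimately show ?thesis using that by blast
qed

section \<open>The trace form\<close>

text \<open>So multiplication by an idempotent has no eigenvalues besides 0, 1/2 and 1.\<close>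

lemma idempotent_cubic:
  assumes "idempotent c"
  shows "2 *\<^sub>R (c \<odot> (c \<odot> (c \<odot> x))) + c \<odot> x = 3 *\<^sub>R (c \<odot> (c \<odot> x))"
proof -
  have "c \<odot> x = c \<odot> (c \<odot> x) + c \<odot> (c \<odot> x) + c \<odot> (c \<odot> x)
      - c \<odot> (c \<odot> (c \<odot> x)) - c \<odot> (c \<odot> (c \<odot> x))"
    using jprod_triple[of c c c x] assms by (simp add: idempotent_def)
  then show ?thesis
    by (rule trans[OF arg_cong[of _ _ "\<lambda>v. 2 *\<^sub>R (c \<odot> (c \<odot> (c \<odot> x))) + v"]])
      (simp add: scaleR_2 scaleR_add_left[of 2 1, simplified] algebra_simps)
qed

lemma inner_peirce_half:
  assumes "idempotent c" "c \<odot> x = (1/2) *\<^sub>R x"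
  shows "inner c x = 0"
  using inner_idempotent_left[OF assms(1), of x] assms by simp

lemma jprod_peirce_half:
  assumes c: "idempotent c" and x: "c \<odot> x = (1/2) *\<^sub>R x" "c \<odot> y = (1/2) *\<^sub>R y"
  shows "c \<odot> (c \<odot> (x \<odot> y)) = c \<odot> (x \<odot> y)"
  using jordan_linearized[of c x y c] c x
  by (simp add: idempotent_def jprod_linear jprod_commute[of x c] jprod_commute[of y c]
      jprod_commute[of "x \<odot> y" c] jprod_commute[of y x])

text \<open>With \<open>L\<close> the multiplication by \<open>p\<close>, the three components are the values at \<open>q\<close> of the spectral
projections \<open>2L\<^sup>2 - L\<close>, \<open>4L - 4L\<^sup>2\<close> and \<open>1 - 3L + 2L\<^sup>2\<close> of \<open>L\<close>.\<close>

lemma peirce_decomposition: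
  assumes p: "primitive_idempotent p"
  obtains l x y where "q = l *\<^sub>R p + x + y" "p \<odot> x = (1/2) *\<^sub>R x" "p \<odot> y = 0"
    "2 *\<^sub>R (p \<odot> (p \<odot> q)) - p \<odot> q = l *\<^sub>R p"
proof -
  have id: "idempotent p" using p by (simp add: primitive_idempotent_def)
  define L where "L = (\<odot>) p"
  have L: "linear L" unfolding L_def by (rule linear_jprod)
  have cub: "2 *\<^sub>R L (L (L q)) = 3 *\<^sub>R L (L q) - L q"
    using idempotent_cubic[OF id, of q] by (simp add: L_def algebra_simps)
  have cub': "L (L (L q)) = (3/2) *\<^sub>R L (L q) - (1/2) *\<^sub>R L q"
    using arg_cong[OF cub, of "\<lambda>v. (1/2) *\<^sub>R v"] by (simp add: scaleR_diff_right)
  note Ls = linear_diff[OF L] linear_add[OF L] linear_cmul[OF L] cub'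
  have "L (2 *\<^sub>R L (L q) - L q) = 2 *\<^sub>R L (L q) - L q"
    unfolding Ls by (rule vector_eq_ldot[THEN iffD1]) (simp add: inner_simps)
  then obtain l where l: "2 *\<^sub>R L (L q) - L q = l *\<^sub>R p"
    using peirce_one_primitive[OF p] unfolding L_def by blast
  define x where "x = 4 *\<^sub>R L q - 4 *\<^sub>R L (L q)"
  define y where "y = q - 3 *\<^sub>R L q + 2 *\<^sub>R L (L q)"
  have "q = (2 *\<^sub>R L (L q) - L q) + x + y"
    unfolding x_def y_def
    by (rule vector_eq_ldot[THEN iffD1]) (simp add: inner_simps)
  moreover have "L x = (1/2) *\<^sub>R x" "L y = 0"
    unfolding x_def y_def Ls
    by (rule vector_eq_ldot[THEN iffD1], simp add: inner_simps)+
  ultimately show ?thesis using that[of l x y] l unfolding L_def by simp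
qed

lemma inner_peirce_coefficient:
  assumes "idempotent p" "2 *\<^sub>R (p \<odot> (p \<odot> q)) - p \<odot> q = l *\<^sub>R p"
  shows "inner p q = l * inner p p"
proof -
  have "inner p q = inner p (2 *\<^sub>R (p \<odot> (p \<odot> q)) - p \<odot> q)"
    by (simp add: inner_simps inner_idempotent_left[OF assms(1), symmetric])
  then show ?thesis unfolding assms(2) by simp
qed

text \<open>Let \<open>l p\<close> be the component of \<open>q\<close> in the 1-space of \<open>p\<close>, and \<open>m q\<close> that of \<open>p\<close> in the 1-space of \<open>q\<close>.
Then \<open>(p, q) = l (p, p) = m (q, q)\<close>, so it suffices to see that \<open>l = m\<close>. This follows by comparing
Peirce components in \<open>q \<odot> q = q\<close> and in the formula for \<open>m q\<close>, unless \<open>q\<close> has no component in the half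
space of \<open>p\<close>. In that case \<open>p = q\<close>, because \<open>q\<close> is primitive and not orthogonal to \<open>p\<close>.\<close>

lemma primitive_nonorthogonal_norm_eq:
  assumes p: "primitive_idempotent p" and q: "primitive_idempotent q" and pq: "inner p q \<noteq> 0"
  shows "inner p p = inner q q"
proof -
  have ip: "idempotent p" and iq: "idempotent q"
    using p q by (simp_all add: primitive_idempotent_def)
  have pp: "p \<odot> p = p" and qq: "q \<odot> q = q" using ip iq by (simp_all add: idempotent_def)
  obtain l x y where dec: "q = l *\<^sub>R p + x + y" and x: "p \<odot> x = (1/2) *\<^sub>R x" and y: "p \<odot> y = 0"
    and l: "2 *\<^sub>R (p \<odot> (p \<odot> q)) - p \<odot> q = l *\<^sub>R p"
    by (rule peirce_decomposition[OF p, of q])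
  obtain m where m: "2 *\<^sub>R (q \<odot> (q \<odot> p)) - q \<odot> p = m *\<^sub>R q"
    by (rule peirce_decomposition[OF q, of p])
  have ipq: "inner p q = l * inner p p" by (rule inner_peirce_coefficient[OF ip l])
  have iqp: "inner q p = m * inner q q" by (rule inner_peirce_coefficient[OF iq m])
  have comm: "inner p q = inner q p" by (rule inner_commute)
  have l0: "l \<noteq> 0" using ipq pq by auto
  obtain s where s: "p \<odot> (x \<odot> x) = s *\<^sub>R p"
    using peirce_one_primitive[OF p jprod_peirce_half[OF ip x x]] by blast
  have cy: "p \<odot> (y \<odot> z) = y \<odot> (p \<odot> z)" for z
    using jcommuteD[OF jcommute_peirce_zero[OF ip y]] .
  have yy: "p \<odot> (y \<odot> y) = 0" using cy y by (simp add: jprod_linear)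
  have xy: "p \<odot> (x \<odot> y) = (1/2) *\<^sub>R (x \<odot> y)"
    using cy[of x] x by (simp add: jprod_linear jprod_commute[of x y])
  have pq1: "p \<odot> q = l *\<^sub>R p + (1/2) *\<^sub>R x" by (simp add: dec jprod_linear x y pp)
  have e1: "l *\<^sub>R p + (1/2) *\<^sub>R x = (l\<^sup>2 + s) *\<^sub>R p + (l/2) *\<^sub>R x + x \<odot> y"
  proof -
    have "q \<odot> q = (l\<^sup>2) *\<^sub>R p + x \<odot> x + y \<odot> y + l *\<^sub>R x + 2 *\<^sub>R (x \<odot> y)"
      unfolding dec jprod_linear jprod_commute[of x p] jprod_commute[of y p] jprod_commute[of y x] x y pp
      by (rule vector_eq_ldot[THEN iffD1]) (simp add: inner_simps power2_eq_square field_simps)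
    then have "p \<odot> q = p \<odot> ((l\<^sup>2) *\<^sub>R p + x \<odot> x + y \<odot> y + l *\<^sub>R x + 2 *\<^sub>R (x \<odot> y))"
      using qq by simp
    then show ?thesis
      unfolding pq1 jprod_linear pp s yy x xy
      by (simp add: algebra_simps)
  qed
  show ?thesis
  proof (cases "x = 0")
    case True
    then have "s *\<^sub>R p = 0" "l *\<^sub>R p = (l\<^sup>2 + s) *\<^sub>R p" using s e1 by (simp_all add: jprod_linear)
    then have "l = 1" using p l0 by (auto simp: primitive_idempotent_def power2_eq_square)
    then have dec': "q = p + y" using dec True by simp
    then have "y \<odot> y = y" using qq pp y by (simp add: jprod_linear jprod_commute[of y p])
    then have "y = 0"
      using p q dec' ip unfolding primitive_idempotent_def[of q] primitive_idempotent_def[of p]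
        idempotent_def by blast
    then show ?thesis using dec' by simp
  next
    case False
    \<comment> \<open>Compare the components of \<open>m q\<close> in the half space of \<open>p\<close>.\<close>
    have qx: "q \<odot> x = (l/2) *\<^sub>R x + x \<odot> x + x \<odot> y"
      by (simp add: dec jprod_linear x jprod_commute[of y x])
    have qp: "q \<odot> p = l *\<^sub>R p + (1/2) *\<^sub>R x" using pq1 by (simp add: jprod_commute)
    have "2 *\<^sub>R (q \<odot> (q \<odot> p)) - q \<odot> p
        = (2 * l\<^sup>2 - l) *\<^sub>R p + (l + l/2 - 1/2) *\<^sub>R x + x \<odot> x + x \<odot> y"
      unfolding qp jprod_linear qx
      by (rule vector_eq_ldot[THEN iffD1]) (simp add: inner_simps power2_eq_square field_simps)
    then have e2: "m *\<^sub>R q = (2 * l\<^sup>2 - l) *\<^sub>R p + (l + l/2 - 1/2) *\<^sub>R x + x \<odot> x + x \<odot> y"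
      using m by simp
    have A: "m *\<^sub>R (l *\<^sub>R p + (1/2) *\<^sub>R x)
       = (2 * l\<^sup>2 - l) *\<^sub>R p + ((l + l/2 - 1/2)/2) *\<^sub>R x + s *\<^sub>R p + (1/2) *\<^sub>R (x \<odot> y)"
      using arg_cong[OF e2, of "(\<odot>) p"] by (simp add: jprod_linear pq1 pp x s xy)
    have xx: "inner p x = 0" using inner_peirce_half[OF ip x] .
    have B1: "inner x x / 2 = l / 2 * inner x x + inner x (x \<odot> y)"
      using arg_cong[OF e1, of "inner x"] xx by (simp add: inner_simps inner_commute[of x p])
    have "m * inner x x / 2 = (l + l/2 - 1/2) / 2 * inner x x + inner x (x \<odot> y) / 2"
      using arg_cong[OF A, of "inner x"] xx by (simp add: inner_simps inner_commute[of x p])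
    then have "m * inner x x / 2 = 3/4 * (l * inner x x) - inner x x / 4 + inner x (x \<odot> y) / 2"
      by (simp add: algebra_simps add_divide_distrib diff_divide_distrib)
    moreover have "inner x x / 2 = (l * inner x x) / 2 + inner x (x \<odot> y)"
      using B1 by simp
    ultimately have "m * inner x x = l * inner x x" by linarith
    then have "m = l" using False by simp
    then show ?thesis using ipq iqp comm l0 by simp
  qed
qed

lemma jordan_frame_finite: "jordan_frame Q \<Longrightarrow> finite Q"
  by (simp add: jordan_frame_def)

text \<open>Each term \<open>(p, q) / (q, q)\<close> equals \<open>(p, q) / (p, p)\<close>, and \<open>\<Sum>q. (p, q) = (p, e) = (p, p)\<close>.\<close>

lemma inner_reciprocal_frame:
  assumes Q: "jordan_frame Q" and p: "primitive_idempotent p"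
  shows "inner p (\<Sum>q\<in>Q. (1 / inner q q) *\<^sub>R q) = 1"
proof -
  have ip: "idempotent p" "p \<noteq> 0" using p by (simp_all add: primitive_idempotent_def)
  have "inner p q / inner q q = inner p q / inner p p" if "q \<in> Q" for q
    using primitive_nonorthogonal_norm_eq[OF p, of q] Q that
    by (cases "inner p q = 0") (auto simp: jordan_frame_def)
  then have "inner p (\<Sum>q\<in>Q. (1 / inner q q) *\<^sub>R q) = (\<Sum>q\<in>Q. inner p q / inner p p)"
    unfolding inner_sum_right by (intro sum.cong) (simp_all add: mult.commute)
  also have "\<dots> = inner p (\<Sum>Q) / inner p p"
    by (simp add: inner_sum_right sum_divide_distrib)
  also have "inner p (\<Sum>Q) = inner p p"
    using Q inner_idempotent_left[OF ip(1), of junit] by (simp add: jordan_frame_def jprod_unit_right)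
  finally show ?thesis using ip by simp
qed

definition trace_vector :: "'a::euclidean_jordan_algebra" where
  "trace_vector = (\<Sum>q\<in>spectral_frame junit. (1 / inner q q) *\<^sub>R q)"

lemma spectral_frame: "jordan_frame (spectral_frame x)"
  and eigval: "x = (\<Sum>q\<in>spectral_frame x. eigval x q *\<^sub>R q)"
proof -
  have "\<exists>Q. jordan_frame Q \<and> (\<exists>l. x = (\<Sum>q\<in>Q. l q *\<^sub>R q))"
    by (rule spectral_theorem[of x]) blast
  then have F: "jordan_frame (spectral_frame x) \<and> (\<exists>l. x = (\<Sum>q\<in>spectral_frame x. l q *\<^sub>R q))"
    unfolding spectral_frame_def by (rule someI_ex)
  then show "jordan_frame (spectral_frame x)" by simp
  have ex: "\<exists>l. x = (\<Sum>q\<in>spectral_frame x. l q *\<^sub>R q)"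
    using F by simp
  show "x = (\<Sum>q\<in>spectral_frame x. eigval x q *\<^sub>R q)"
    unfolding eigval_def using ex by (rule someI_ex)
qed

lemma inner_trace_vector_primitive: "primitive_idempotent p \<Longrightarrow> inner p trace_vector = 1"
  unfolding trace_vector_def by (rule inner_reciprocal_frame[OF spectral_frame])

lemma inner_trace_vector_frame:
  "jordan_frame Q \<Longrightarrow> inner (\<Sum>q\<in>Q. l q *\<^sub>R q) trace_vector = (\<Sum>q\<in>Q. l q)"
  by (auto simp: inner_sum_left jordan_frame_def inner_trace_vector_primitive)

lemma jtrace_eq_inner: "jtrace x = inner x trace_vector"
  unfolding jtrace_def
  by (subst (3) eigval) (simp add: inner_trace_vector_frame spectral_frame)

lemma jtrace_frame: "jordan_frame Q \<Longrightarrow> jtrace (\<Sum>q\<in>Q. l q *\<^sub>R q) = (\<Sum>q\<in>Q. l q)"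
  by (simp add: jtrace_eq_inner inner_trace_vector_frame)

lemma jtrace_primitive: "primitive_idempotent q \<Longrightarrow> jtrace q = 1"
  by (simp add: jtrace_eq_inner inner_trace_vector_primitive)

lemma trace_vector_eq_frame:
  assumes "jordan_frame Q"
  shows "trace_vector = (\<Sum>q\<in>Q. (1 / inner q q) *\<^sub>R q)" (is "_ = ?v")
proof (rule vector_eq_ldot[THEN iffD1], rule allI)
  fix x
  have "inner x ?v = (\<Sum>p\<in>spectral_frame x. eigval x p * inner p ?v)"
    by (subst eigval[of x]) (simp only: inner_sum_left inner_scaleR_left)
  also have "\<dots> = (\<Sum>p\<in>spectral_frame x. eigval x p)"
    using spectral_frame[of x] by (simp add: jordan_frame_def inner_reciprocal_frame[OF assms])
  finally show "inner x trace_vector = inner x ?v"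
    by (simp add: jtrace_def flip: jtrace_eq_inner)
qed

lemma jcommute_frame_span:
  assumes Q: "jordan_frame Q"
  shows "jcommute (\<Sum>q\<in>Q. l q *\<^sub>R q) (\<Sum>q\<in>Q. m q *\<^sub>R q)"
proof (rule jcommute_span)
  show "jcommute p q" if "p \<in> Q" "q \<in> Q" for p q
    using Q that jcommute_peirce_zero[of p q]
    by (cases "p = q") (auto simp: jordan_frame_def primitive_idempotent_def jcommute_refl)
qed (auto intro: span_sum span_scale span_base)

text \<open>A frame that diagonalizes \<open>x\<close> also expresses the trace vector, and elements of one frame
operator-commute.\<close>

lemma jcommute_trace_vector: "jcommute x trace_vector"
  by (subst eigval[of x], subst trace_vector_eq_frame[OF spectral_frame[of x]])
    (rule jcommute_frame_span[OF spectral_frame])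

lemma jtrace_linear:
  "jtrace (x + y) = jtrace x + jtrace y" "jtrace (c *\<^sub>R x) = c * jtrace x"
  "jtrace (x - y) = jtrace x - jtrace y" "jtrace (- x) = - jtrace x" "jtrace 0 = 0"
  by (simp_all add: jtrace_eq_inner inner_simps)

lemma jtrace_sum: "jtrace (sum f S) = (\<Sum>i\<in>S. jtrace (f i))"
  by (simp add: jtrace_eq_inner inner_sum_left)

lemma jinner_commute: "jinner x y = jinner y x"
  by (simp add: jinner_def jprod_commute)

text \<open>The given inner product is associative, and the trace form differs from it by multiplication
with the trace vector, which operator-commutes with \<open>y\<close>.\<close>

lemma jinner_assoc: "jinner (x \<odot> y) z = jinner x (y \<odot> z)"
proof -
  have "jinner (x \<odot> y) z = inner x (y \<odot> (trace_vector \<odot> z))"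
    by (simp add: jinner_def jtrace_eq_inner jprod_inner_assoc jprod_commute[of z])
  also have "y \<odot> (trace_vector \<odot> z) = trace_vector \<odot> (y \<odot> z)"
    by (rule jcommuteD[OF jcommute_trace_vector])
  also have "inner x (trace_vector \<odot> (y \<odot> z)) = jinner x (y \<odot> z)"
    by (simp add: jinner_def jtrace_eq_inner jprod_inner_assoc jprod_commute[of trace_vector])
  finally show ?thesis .
qed

lemma jinner_linear:
  "jinner (x + y) z = jinner x z + jinner y z" "jinner (c *\<^sub>R x) z = c * jinner x z"
  "jinner (x - y) z = jinner x z - jinner y z" "jinner (- x) z = - jinner x z" "jinner 0 z = 0"
  "jinner z (x + y) = jinner z x + jinner z y" "jinner z (c *\<^sub>R x) = c * jinner z x"
  "jinner z (x - y) = jinner z x - jinner z y" "jinner z (- x) = - jinner z x" "jinner z 0 = 0"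
  by (simp_all add: jinner_def jprod_linear jtrace_linear)

lemma jinner_sum_left: "jinner (sum f S) x = (\<Sum>i\<in>S. jinner (f i) x)"
  by (simp add: jinner_def jprod_sum_left jtrace_sum)

lemma jinner_sum_right: "jinner x (sum f S) = (\<Sum>i\<in>S. jinner x (f i))"
  by (simp add: jinner_def jprod_sum_right jtrace_sum)

lemma jinner_unit: "jinner junit x = jtrace x" "jinner x junit = jtrace x"
  by (simp_all add: jinner_def jprod_unit jprod_unit_right)

lemma jinner_self_nonneg: "0 \<le> jinner x x"
proof -
  let ?Q = "spectral_frame x"
  have Q: "orthogonal_idempotents ?Q" using spectral_frame[of x] by (simp add: jordan_frame_iff)
  have "x \<odot> x = (\<Sum>p\<in>?Q. eigval x p *\<^sub>R (p \<odot> x))"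
    by (subst (1) eigval[of x]) (simp add: jprod_sum_left jprod_linear)
  also have "\<dots> = (\<Sum>p\<in>?Q. (eigval x p)\<^sup>2 *\<^sub>R p)"
  proof (rule sum.cong[OF refl])
    fix p assume "p \<in> ?Q"
    then have "p \<odot> x = eigval x p *\<^sub>R p"
      by (subst eigval[of x]) (rule jprod_sum_orthogonal_idempotents[OF Q])
    then show "eigval x p *\<^sub>R (p \<odot> x) = (eigval x p)\<^sup>2 *\<^sub>R p" by (simp add: power2_eq_square)
  qed
  finally show ?thesis
    by (simp add: jinner_def jtrace_frame[OF spectral_frame] sum_nonneg)
qed

text \<open>The multiplication \<open>L\<close> by \<open>c\<close> has the eigenvalues 0, 1/2 and 1. So \<open>L = L\<^sup>2 + P / 4\<close>, where
\<open>P = 4 (L - L\<^sup>2)\<close> is the projection to the eigenspace of 1/2, and both terms are positive semidefinite.\<close>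

lemma jinner_idempotent_nonneg:
  assumes c: "idempotent c"
  shows "0 \<le> jinner (c \<odot> x) x"
proof -
  define L where "L = (\<odot>) c"
  have L: "linear L" unfolding L_def by (rule linear_jprod)
  have sym: "jinner (L u) v = jinner u (L v)" for u v
    unfolding L_def using jinner_assoc[of u c v] by (simp add: jprod_commute)
  have cub: "L (L (L v)) = (3/2) *\<^sub>R L (L v) - (1/2) *\<^sub>R L v" for v
  proof -
    have e: "2 *\<^sub>R L (L (L v)) = 3 *\<^sub>R L (L v) - L v"
      using idempotent_cubic[OF c, of v] by (simp add: L_def algebra_simps)
    show ?thesis
      using arg_cong[OF e, of "\<lambda>v. (1/2) *\<^sub>R v"] by (simp add: scaleR_diff_right)
  qed
  define w where "w = L x - L (L x)"
  have Lw: "L w = (1/2) *\<^sub>R w"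
    unfolding w_def linear_diff[OF L] cub
    by (rule vector_eq_ldot[THEN iffD1]) (simp add: inner_simps)
  have "jinner w w = jinner (L x) w - jinner (L (L x)) w"
    by (subst (1) w_def) (simp add: jinner_linear)
  also have "\<dots> = jinner x w / 4" by (simp add: sym Lw jinner_linear)
  finally have "jinner x w = 4 * jinner w w" by simp
  then have "jinner (L x) x = jinner (L x) (L x) + 4 * jinner w w"
    using sym[of x x] sym[of x "L x"] sym[of "L x" x] by (simp add: w_def jinner_linear)
  then show ?thesis using jinner_self_nonneg[of "L x"] jinner_self_nonneg[of w] by (simp add: L_def)
qed

lemma jinner_idempotents_nonneg:
  assumes "idempotent p" "idempotent q"
  shows "0 \<le> jinner p q"
  using jinner_idempotent_nonneg[OF assms(1), of q] assms(2) jinner_assoc[of p q q]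
  by (simp add: idempotent_def)

section \<open>The cone of squares and functional calculus\<close>

text \<open>The cardinality of a frame is the trace of the unit.\<close>

lemma card_jordan_frame:
  assumes "jordan_frame (Q :: 'a::euclidean_jordan_algebra set)"
  shows "card Q = jrank TYPE('a)"
proof -
  have c: "real (card R) = jtrace (junit :: 'a)" if "jordan_frame R" for R :: "'a set"
  proof -
    have "jtrace (\<Sum>q\<in>R. 1 *\<^sub>R q) = (\<Sum>q\<in>R. 1)" by (rule jtrace_frame[OF that])
    then show ?thesis using that by (simp add: jordan_frame_def)
  qed
  have "jrank TYPE('a) = card Q"
    unfolding jrank_def
  proof (rule the_equality)
    show "\<forall>R :: 'a set. jordan_frame R \<longrightarrow> card R = card Q"
      using c assms by (metis of_nat_eq_iff)
  qed (use assms in blast)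
  then show ?thesis by simp
qed

lemma jtrace_unit: "jtrace (junit :: 'a::euclidean_jordan_algebra) = real (jrank TYPE('a))"
proof -
  let ?Q = "spectral_frame (junit :: 'a)"
  have "jtrace (\<Sum>q\<in>?Q. 1 *\<^sub>R q) = (\<Sum>q\<in>?Q. 1)" by (rule jtrace_frame[OF spectral_frame])
  then show ?thesis
    using spectral_frame[of "junit :: 'a"] card_jordan_frame[OF spectral_frame[of "junit :: 'a"]]
    by (simp add: jordan_frame_def)
qed

lemma jordan_frame_nonempty: "jordan_frame Q \<Longrightarrow> Q \<noteq> {}"
  using junit_nonzero by (auto simp: jordan_frame_def)

lemma jinner_square_idempotent_nonneg: "idempotent q \<Longrightarrow> 0 \<le> jinner q (x \<odot> x)"
  using jinner_idempotent_nonneg[of q x] by (simp add: jinner_assoc)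

lemma jinner_cone_idempotent_nonneg:
  "x \<in> cone_of_squares \<Longrightarrow> idempotent q \<Longrightarrow> 0 \<le> jinner q x"
  by (auto simp: cone_of_squares_def jinner_square_idempotent_nonneg)

lemma frame_jprod:
  assumes "jordan_frame Q"
  shows "(\<Sum>q\<in>Q. l q *\<^sub>R q) \<odot> (\<Sum>q\<in>Q. m q *\<^sub>R q) = (\<Sum>q\<in>Q. (l q * m q) *\<^sub>R q)"
proof -
  have Q: "orthogonal_idempotents Q" using assms by (simp add: jordan_frame_iff)
  have "(\<Sum>q\<in>Q. l q *\<^sub>R q) \<odot> (\<Sum>q\<in>Q. m q *\<^sub>R q)
    = (\<Sum>p\<in>Q. l p *\<^sub>R (p \<odot> (\<Sum>q\<in>Q. m q *\<^sub>R q)))"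
    by (simp only: jprod_sum_left jprod_scaleR_left)
  also have "\<dots> = (\<Sum>q\<in>Q. (l q * m q) *\<^sub>R q)"
    by (intro sum.cong refl) (simp add: jprod_sum_orthogonal_idempotents[OF Q])
  finally show ?thesis .
qed

lemma frame_in_cone:
  assumes Q: "jordan_frame Q" and "\<And>q. q \<in> Q \<Longrightarrow> 0 \<le> l q"
  shows "(\<Sum>q\<in>Q. l q *\<^sub>R q) \<in> cone_of_squares"
proof -
  have "(\<Sum>q\<in>Q. l q *\<^sub>R q) = (\<Sum>q\<in>Q. (sqrt (l q) * sqrt (l q)) *\<^sub>R q)"
    using assms by (intro sum.cong) auto
  also have "\<dots> = (\<Sum>q\<in>Q. sqrt (l q) *\<^sub>R q) \<odot> (\<Sum>q\<in>Q. sqrt (l q) *\<^sub>R q)"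
    by (rule frame_jprod[OF Q, symmetric])
  finally show ?thesis unfolding cone_of_squares_def by (rule range_eqI)
qed

text \<open>The eigenvalues of \<open>x\<close> are its trace inner products with the elements of its spectral frame.\<close>

lemma cone_of_squaresI:
  fixes x :: "'a::euclidean_jordan_algebra"
  assumes "\<And>q::'a. idempotent q \<Longrightarrow> 0 \<le> jinner q x"
  shows "x \<in> cone_of_squares"
proof -
  let ?Q = "spectral_frame x"
  have "0 \<le> eigval x q" if q: "q \<in> ?Q" for q
  proof -
    have Q: "orthogonal_idempotents ?Q" and p: "primitive_idempotent q"
      using spectral_frame[of x] q by (simp_all add: jordan_frame_iff)
    have "q \<odot> x = eigval x q *\<^sub>R q"
      by (subst eigval[of x]) (rule jprod_sum_orthogonal_idempotents[OF Q q])
    then have "jinner q x = eigval x q"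
      by (simp add: jinner_def jtrace_linear jtrace_primitive[OF p])
    then show ?thesis using assms[of q] p by (simp add: primitive_idempotent_def)
  qed
  then have "(\<Sum>q\<in>?Q. eigval x q *\<^sub>R q) \<in> cone_of_squares"
    by (intro frame_in_cone spectral_frame)
  then show ?thesis by (simp flip: eigval)
qed

lemma cone_of_squares_iff: "x \<in> cone_of_squares \<longleftrightarrow> (\<forall>q. idempotent q \<longrightarrow> 0 \<le> jinner q x)"
  using cone_of_squaresI jinner_cone_idempotent_nonneg by blast

lemma cone_of_squares_scaleR: "x \<in> cone_of_squares \<Longrightarrow> 0 \<le> c \<Longrightarrow> c *\<^sub>R x \<in> cone_of_squares"
  by (simp add: cone_of_squares_iff jinner_linear)

lemma cone_of_squares_sum:
  "(\<And>i. i \<in> S \<Longrightarrow> f i \<in> cone_of_squares) \<Longrightarrow> sum f S \<in> cone_of_squares"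
  by (simp add: cone_of_squares_iff jinner_sum_right sum_nonneg)

definition jfun :: "(real \<Rightarrow> real) \<Rightarrow> 'a::euclidean_jordan_algebra \<Rightarrow> 'a" where
  "jfun f x = (\<Sum>q\<in>spectral_frame x. f (eigval x q) *\<^sub>R q)"

lemma jexp_eq_jfun: "jexp x = jfun exp x"
  by (simp add: jexp_def jfun_def)

lemma jfun_ident: "jfun (\<lambda>t. t) x = x"
  by (simp add: jfun_def flip: eigval)

lemma jfun_const: "jfun (\<lambda>t. 1) x = junit"
  using spectral_frame[of x] by (simp add: jfun_def jordan_frame_def)

lemma jfun_mult: "jfun f x \<odot> jfun g x = jfun (\<lambda>t. f t * g t) x"
  unfolding jfun_def by (rule frame_jprod[OF spectral_frame])

lemma jfun_jprod_ident: "jfun f x \<odot> x = jfun (\<lambda>t. f t * t) x"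
  using jfun_mult[of f x "\<lambda>t. t"] by (simp add: jfun_ident)

lemma jtrace_jfun: "jtrace (jfun f x) = (\<Sum>q\<in>spectral_frame x. f (eigval x q))"
  unfolding jfun_def by (rule jtrace_frame[OF spectral_frame])

lemma jinner_jfun:
  "jinner (jfun f x) (jfun g y) =
    (\<Sum>p\<in>spectral_frame x. \<Sum>q\<in>spectral_frame y. f (eigval x p) * g (eigval y q) * jinner p q)"
  by (simp only: jfun_def jinner_sum_left)
    (simp add: jinner_sum_right jinner_linear sum_distrib_left mult.assoc mult.left_commute)

text \<open>The matrix of the weights \<open>jinner p q\<close> of two frames is nonnegative, so an inequality between sums
of products of scalar functions lifts to two elements that need not operator-commute.\<close>

lemma jinner_jfun_nonneg:
  assumes "\<And>s t. 0 \<le> (\<Sum>i\<in>I. f i s * g i t)"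
  shows "0 \<le> (\<Sum>i\<in>I. jinner (jfun (f i) x) (jfun (g i) y))"
proof -
  have "(\<Sum>i\<in>I. jinner (jfun (f i) x) (jfun (g i) y)) =
    (\<Sum>p\<in>spectral_frame x. \<Sum>q\<in>spectral_frame y.
       (\<Sum>i\<in>I. f i (eigval x p) * g i (eigval y q)) * jinner p q)"
    unfolding jinner_jfun
    by (subst sum.swap, intro sum.cong refl, subst sum.swap, intro sum.cong refl)
      (simp add: sum_distrib_right)
  moreover have "0 \<le> jinner p q" if "p \<in> spectral_frame x" "q \<in> spectral_frame y" for p q
    using spectral_frame[of x] spectral_frame[of y] that
    by (intro jinner_idempotents_nonneg) (auto simp: jordan_frame_def primitive_idempotent_def)
  ultimately show ?thesis by (auto intro!: sum_nonneg mult_nonneg_nonneg assms)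
qed

lemma jtrace_jexp_pos: "0 < jtrace (jexp x)"
  using spectral_frame[of x] jordan_frame_nonempty[OF spectral_frame[of x]]
  by (simp add: jexp_eq_jfun jtrace_jfun jordan_frame_def sum_pos)

lemma jexp_in_cone: "jexp x \<in> cone_of_squares"
  unfolding jexp_def by (rule frame_in_cone[OF spectral_frame]) simp

lemma jexp_zero: "jexp 0 = junit"
proof -
  let ?Q = "spectral_frame (0::'a)"
  have Q: "orthogonal_idempotents ?Q" using spectral_frame[of "0::'a"] by (simp add: jordan_frame_iff)
  have "eigval 0 q = 0" if "q \<in> ?Q" for q
  proof -
    have "eigval 0 q *\<^sub>R q = q \<odot> (\<Sum>q\<in>?Q. eigval 0 q *\<^sub>R q)"
      by (rule jprod_sum_orthogonal_idempotents[OF Q that, symmetric])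
    also have "\<dots> = 0" by (simp add: jprod_linear flip: eigval)
    finally show ?thesis using Q that by (auto simp: orthogonal_idempotents_def)
  qed
  then show ?thesis using spectral_frame[of "0::'a"] by (simp add: jexp_def jordan_frame_def)
qed

section \<open>The logarithm of the trace exponential\<close>

definition log_partition :: "'a::euclidean_jordan_algebra \<Rightarrow> real" where
  "log_partition y = ln (jtrace (jexp y))"

definition gibbs :: "'a::euclidean_jordan_algebra \<Rightarrow> 'a" where
  "gibbs y = (1 / jtrace (jexp y)) *\<^sub>R jexp y"

lemma log_partition_zero:
  "log_partition (0::'a::euclidean_jordan_algebra) = ln (real (jrank TYPE('a)))"
  by (simp add: log_partition_def jexp_zero jtrace_unit)

lemma gibbs_in_cone: "gibbs y \<in> cone_of_squares"
  unfolding gibbs_def using jtrace_jexp_pos[of y]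
  by (intro cone_of_squares_scaleR jexp_in_cone) simp

lemma jtrace_gibbs: "jtrace (gibbs y) = 1"
  using jtrace_jexp_pos[of y] by (simp add: gibbs_def jtrace_linear)

lemma gibbs_eq_jfun: "gibbs y = jfun (\<lambda>t. exp (t - log_partition y)) y"
  using jtrace_jexp_pos[of y]
  by (simp add: gibbs_def jexp_def jfun_def log_partition_def scaleR_sum_right exp_diff)

definition gibbs_root :: "'a::euclidean_jordan_algebra \<Rightarrow> 'a" where
  "gibbs_root y = jfun (\<lambda>t. exp ((t - log_partition y) / 2)) y"

lemma gibbs_root_square: "gibbs_root y \<odot> gibbs_root y = gibbs y"
  by (simp add: gibbs_root_def gibbs_eq_jfun jfun_mult flip: exp_add)

lemma jinner_gibbs_root: "jinner (gibbs_root y) (gibbs_root y) = 1"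
  by (simp add: jinner_def gibbs_root_square jtrace_gibbs)

lemma log_partition_ge:
  assumes x: "x \<in> cone_of_squares" "jtrace x = 1"
  shows "jinner x y \<le> log_partition y"
proof -
  let ?Q = "spectral_frame y"
  have w: "0 \<le> jinner q x" if "q \<in> ?Q" for q
    using spectral_frame[of y] that jinner_cone_idempotent_nonneg[OF x(1)]
    by (auto simp: jordan_frame_def primitive_idempotent_def)
  have le: "eigval y q \<le> log_partition y" if "q \<in> ?Q" for q
  proof -
    have "exp (eigval y q) \<le> (\<Sum>q\<in>?Q. exp (eigval y q))"
      using spectral_frame[of y] that
      by (intro member_le_sum) (auto simp: jordan_frame_def)
    also have "\<dots> = jtrace (jexp y)" by (simp add: jexp_eq_jfun jtrace_jfun)
    finally show ?thesis unfolding log_partition_def using jtrace_jexp_pos[of y]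
      by (simp add: ln_ge_iff)
  qed
  have "jinner x y = (\<Sum>q\<in>?Q. eigval y q * jinner q x)"
    by (subst jinner_commute, subst eigval[of y]) (simp add: jinner_sum_left jinner_linear)
  also have "\<dots> \<le> (\<Sum>q\<in>?Q. log_partition y * jinner q x)"
    by (intro sum_mono mult_right_mono le w)
  also have "\<dots> = log_partition y * jinner (\<Sum>?Q) x"
    by (simp add: jinner_sum_left sum_distrib_left)
  also have "\<dots> = log_partition y"
    using spectral_frame[of y] x by (simp add: jordan_frame_def jinner_unit)
  finally show ?thesis .
qed

text \<open>The lifted scalar inequality is \<open>v (ln u - ln v) \<le> u - v\<close> for the eigenvalues \<open>v\<close>, \<open>u\<close> of the Gibbs
states of \<open>y\<close> and \<open>y + h\<close>.\<close>

lemma log_partition_convex: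
  "log_partition y + jinner (gibbs y) h \<le> log_partition (y + h)"
proof -
  define Z Z' where "Z = log_partition y" and "Z' = log_partition (y + h)"
  define f where "f t = exp (t - Z)" for t
  define g where "g s = exp (s - Z')" for s
  \<comment> \<open>The scalar inequality, split into a sum of three products of a function of \<open>t\<close> and one of \<open>s\<close>.\<close>
  define F G :: "nat \<Rightarrow> real \<Rightarrow> real"
    where "F = (!) [\<lambda>t. 1, \<lambda>t. f t * (t - Z + Z' - 1), \<lambda>t. - f t]"
      and "G = (!) [g, \<lambda>s. 1, \<lambda>s. s]"
  have "0 \<le> (\<Sum>i<3. F i t * G i s)" for s t
  proof -
    have "f t * (1 + ((s - Z') - (t - Z))) \<le> f t * exp ((s - Z') - (t - Z))"
      by (intro mult_left_mono exp_ge_add_one_self) (simp add: f_def)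
    also have "\<dots> = g s" by (simp add: f_def g_def flip: exp_add)
    finally show ?thesis by (simp add: F_def G_def numeral_3_eq_3 algebra_simps)
  qed
  then have "0 \<le> (\<Sum>i<3. jinner (jfun (F i) y) (jfun (G i) (y + h)))"
    by (rule jinner_jfun_nonneg)
  moreover have "jfun (\<lambda>t. f t * (t - Z + Z' - 1)) y = gibbs y \<odot> y + (Z' - Z - 1) *\<^sub>R gibbs y"
  proof -
    have "gibbs y \<odot> y = jfun (\<lambda>t. f t * t) y"
      by (simp add: gibbs_eq_jfun jfun_jprod_ident f_def Z_def)
    then show ?thesis
      by (simp add: gibbs_eq_jfun jfun_def f_def Z_def scaleR_sum_right algebra_simps
          flip: sum.distrib sum_subtractf)
  qed
  moreover have "jfun (\<lambda>t. - f t) y = - gibbs y"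
    by (simp add: gibbs_eq_jfun jfun_def f_def Z_def sum_negf)
  moreover have "jfun g (y + h) = gibbs (y + h)"
    unfolding g_def Z'_def gibbs_eq_jfun ..
  ultimately have "0 \<le> 1 + (jinner (gibbs y) y + (Z' - Z - 1)) - jinner (gibbs y) (y + h)"
    by (simp add: F_def G_def numeral_3_eq_3 jfun_const jfun_ident jinner_unit jinner_linear
        jtrace_linear jtrace_gibbs flip: jinner_def)
  then show ?thesis by (simp add: jinner_linear Z_def Z'_def)
qed

text \<open>The difference of the two sides is the relative entropy of the two Gibbs states minus the squared
distance of their square roots. The lifted scalar inequality is
\<open>u (ln u - ln v) - u + v \<ge> (sqrt u - sqrt v)\<^sup>2\<close> for the eigenvalues \<open>u\<close>, \<open>v\<close> of the Gibbs states of
\<open>y + h\<close> and \<open>y\<close>.\<close>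

lemma log_partition_increment_le:
  "log_partition (y + h) - log_partition y
    \<le> jinner (gibbs (y + h)) h
      - jinner (gibbs_root (y + h) - gibbs_root y) (gibbs_root (y + h) - gibbs_root y)"
proof -
  define Z Z' where "Z = log_partition y" and "Z' = log_partition (y + h)"
  define g where "g s = exp (s - Z')" for s
  define a where "a t = exp ((t - Z) / 2)" for t
  define b where "b s = exp ((s - Z') / 2)" for s
  \<comment> \<open>With the square expanded, the scalar inequality is \<open>0 \<le> u (ln u - ln v) - 2 u + 2 sqrt u sqrt v\<close>.\<close>
  define F G :: "nat \<Rightarrow> real \<Rightarrow> real"
    where "F = (!) [\<lambda>s. g s * (s - Z' + Z - 2), \<lambda>s. - g s, \<lambda>s. 2 * b s]"
      and "G = (!) [\<lambda>t. 1, \<lambda>t. t, a]"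
  have "0 \<le> (\<Sum>i<3. F i s * G i t)" for s t
  proof -
    have "g s * (2 + (t - Z) - (s - Z')) = 2 * g s * (1 + ((t - Z) - (s - Z')) / 2)"
      by (simp add: field_simps)
    also have "\<dots> \<le> 2 * g s * exp (((t - Z) - (s - Z')) / 2)"
      by (intro mult_left_mono exp_ge_add_one_self) (simp add: g_def)
    also have "\<dots> = 2 * b s * a t"
      by (simp add: a_def b_def g_def field_simps flip: exp_add)
    finally show ?thesis by (simp add: F_def G_def numeral_3_eq_3 algebra_simps)
  qed
  then have "0 \<le> (\<Sum>i<3. jinner (jfun (F i) (y + h)) (jfun (G i) y))"
    by (rule jinner_jfun_nonneg)
  moreover have "jfun (\<lambda>s. g s * (s - Z' + Z - 2)) (y + h)
      = gibbs (y + h) \<odot> (y + h) + (Z - Z' - 2) *\<^sub>R gibbs (y + h)"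
  proof -
    have "gibbs (y + h) \<odot> (y + h) = jfun (\<lambda>s. g s * s) (y + h)"
      by (simp add: gibbs_eq_jfun jfun_jprod_ident g_def Z'_def)
    then show ?thesis
      by (simp add: gibbs_eq_jfun jfun_def g_def Z'_def scaleR_sum_right algebra_simps
          flip: sum.distrib sum_subtractf)
  qed
  moreover have "jfun (\<lambda>s. - g s) (y + h) = - gibbs (y + h)"
    by (simp add: gibbs_eq_jfun jfun_def g_def Z'_def sum_negf)
  moreover have "jfun (\<lambda>s. 2 * b s) (y + h) = 2 *\<^sub>R gibbs_root (y + h)"
    by (simp add: gibbs_root_def jfun_def b_def Z'_def scaleR_sum_right)
  moreover have "jfun a y = gibbs_root y"
    unfolding a_def Z_def gibbs_root_def ..
  ultimately have "0 \<le> jinner (gibbs (y + h)) (y + h) + (Z - Z' - 2) - jinner (gibbs (y + h)) y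
      + 2 * jinner (gibbs_root (y + h)) (gibbs_root y)"
    by (simp add: F_def G_def numeral_3_eq_3 jfun_const jfun_ident jinner_unit jinner_linear
        jtrace_linear jtrace_gibbs flip: jinner_def)
  then show ?thesis
    by (simp add: jinner_linear Z_def Z'_def jinner_gibbs_root
        jinner_commute[of "gibbs_root y" "gibbs_root (y + h)"])
qed

text \<open>For each \<open>q\<close> in the frame, the form \<open>Tr (q \<odot> (u \<odot> v))\<close> is positive semidefinite, and its value at
\<open>u - (l q / 2) v\<close> gives the summand for \<open>q\<close>.\<close>

lemma jinner_jprod_le:
  assumes Q: "jordan_frame Q" and h: "h = (\<Sum>q\<in>Q. l q *\<^sub>R q)" and l: "\<And>q. q \<in> Q \<Longrightarrow> \<bar>l q\<bar> \<le> M"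
  shows "jinner (u \<odot> v) h \<le> jinner u u + M\<^sup>2 / 4 * jinner v v"
proof -
  have id: "idempotent q" if "q \<in> Q" for q
    using Q that by (simp add: jordan_frame_def primitive_idempotent_def)
  have one: "l q * jinner q (u \<odot> v) \<le> jinner q (u \<odot> u) + M\<^sup>2 / 4 * jinner q (v \<odot> v)" if q: "q \<in> Q" for q
  proof -
    let ?w = "u - (l q / 2) *\<^sub>R v"
    have "?w \<odot> ?w = u \<odot> u - l q *\<^sub>R (u \<odot> v) + ((l q)\<^sup>2 / 4) *\<^sub>R (v \<odot> v)"
      unfolding jprod_linear jprod_commute[of v u]
      by (rule vector_eq_ldot[THEN iffD1]) (simp add: inner_simps power2_eq_square field_simps)
    then have "0 \<le> jinner q (u \<odot> u) - l q * jinner q (u \<odot> v) + (l q)\<^sup>2 / 4 * jinner q (v \<odot> v)"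
      using jinner_square_idempotent_nonneg[OF id[OF q], of ?w] by (simp add: jinner_linear)
    moreover have "(l q)\<^sup>2 / 4 * jinner q (v \<odot> v) \<le> M\<^sup>2 / 4 * jinner q (v \<odot> v)"
      using l[OF q] jinner_square_idempotent_nonneg[OF id[OF q], of v]
      by (intro mult_right_mono divide_right_mono) (auto simp: power2_le_iff_abs_le abs_le_square_iff[symmetric])
    ultimately show ?thesis by simp
  qed
  have "jinner (u \<odot> v) h = (\<Sum>q\<in>Q. l q * jinner q (u \<odot> v))"
    unfolding h by (subst jinner_commute) (simp add: jinner_sum_left jinner_linear)
  also have "\<dots> \<le> (\<Sum>q\<in>Q. jinner q (u \<odot> u) + M\<^sup>2 / 4 * jinner q (v \<odot> v))"
    by (intro sum_mono one)
  also have "\<dots> = jinner (\<Sum>Q) (u \<odot> u) + M\<^sup>2 / 4 * jinner (\<Sum>Q) (v \<odot> v)"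
    by (simp add: jinner_sum_left sum.distrib sum_distrib_left)
  also have "\<dots> = jinner u u + M\<^sup>2 / 4 * jinner v v"
    using Q by (simp add: jordan_frame_def jprod_unit jinner_def)
  finally show ?thesis .
qed

lemma log_partition_smooth:
  assumes Q: "jordan_frame Q" and h: "h = (\<Sum>q\<in>Q. l q *\<^sub>R q)" and l: "\<And>q. q \<in> Q \<Longrightarrow> \<bar>l q\<bar> \<le> M"
  shows "log_partition (y + h) \<le> log_partition y + jinner (gibbs y) h + M\<^sup>2"
proof -
  define a b where "a = gibbs_root y" and "b = gibbs_root (y + h)"
  have n: "jinner a a = 1" "jinner b b = 1" by (simp_all add: a_def b_def jinner_gibbs_root)
  have "gibbs (y + h) - gibbs y = (b - a) \<odot> (b + a)"
    by (simp add: a_def b_def jprod_linear gibbs_root_square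
        jprod_commute[of "gibbs_root y" "gibbs_root (y + h)"])
  then have "jinner (gibbs (y + h)) h - jinner (gibbs y) h = jinner ((b - a) \<odot> (b + a)) h"
    by (simp flip: jinner_linear)
  also have "\<dots> \<le> jinner (b - a) (b - a) + M\<^sup>2 / 4 * jinner (b + a) (b + a)"
    by (rule jinner_jprod_le[OF Q h l])
  also have "jinner (b + a) (b + a) \<le> 4"
    using jinner_self_nonneg[of "b - a"] n by (simp add: jinner_linear jinner_commute[of a b])
  finally have "jinner (gibbs (y + h)) h - jinner (gibbs y) h \<le> jinner (b - a) (b - a) + M\<^sup>2"
    by (simp add: mult_left_mono)
  then show ?thesis
    using log_partition_increment_le[of y h] by (simp add: a_def b_def)
qed

section \<open>The multiplicative weights method\<close>

text \<open>The iterate is the Gibbs state of this exponent. For the empty list of answers the exponent is 0,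
whose Gibbs state is the initial point.\<close>

definition mwu_exponent ::
  "real \<Rightarrow> 'a::euclidean_jordan_algebra ^ 'm::finite \<Rightarrow> 'm list \<Rightarrow> 'a" where
  "mwu_exponent \<alpha> A ps = - (step_size \<alpha> A *\<^sub>R (\<Sum>p\<leftarrow>ps. (1 / width A) *\<^sub>R A $ p))"

lemma mwu_iterate_eq_gibbs: "mwu_iterate \<alpha> A ps = gibbs (mwu_exponent \<alpha> A ps)"
  by (simp add: mwu_iterate_def mwu_exponent_def gibbs_def jexp_zero jtrace_unit Let_def)

lemma mwu_exponent_snoc:
  "mwu_exponent \<alpha> A (ps @ [p]) = mwu_exponent \<alpha> A ps - (step_size \<alpha> A / width A) *\<^sub>R A $ p"
  by (simp add: mwu_exponent_def scaleR_add_right)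

lemma jnorm_inf_ge: "q \<in> spectral_frame x \<Longrightarrow> \<bar>eigval x q\<bar> \<le> jnorm_inf x"
  using jordan_frame_finite[OF spectral_frame[of x]] by (simp add: jnorm_inf_def)

lemma jnorm_inf_nonneg: "0 \<le> jnorm_inf x"
proof -
  obtain q where "q \<in> spectral_frame x" using jordan_frame_nonempty[OF spectral_frame[of x]] by auto
  from jnorm_inf_ge[OF this] show ?thesis by linarith
qed

lemma jnorm_inf_le_width: "jnorm_inf (A $ i) \<le> width A"
  by (simp add: width_def)

lemma width_nonneg: "0 \<le> width A"
  using jnorm_inf_nonneg jnorm_inf_le_width by (rule order_trans)

lemma width_zero:
  assumes "width A = 0"
  shows "A $ i = 0"
proof -
  have "eigval (A $ i) q = 0" if "q \<in> spectral_frame (A $ i)" for q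
    using jnorm_inf_ge[OF that] jnorm_inf_le_width[of A i] assms by simp
  then have "(\<Sum>q\<in>spectral_frame (A $ i). eigval (A $ i) q *\<^sub>R q) = 0"
    by simp
  then show ?thesis by (simp flip: eigval)
qed

definition max_violation :: "'a::euclidean_jordan_algebra ^ 'm::finite \<Rightarrow> real ^ 'm \<Rightarrow> 'a \<Rightarrow> real" where
  "max_violation A b x = (MAX j. jinner (A $ j) x - b $ j)"

lemma max_violation_ge: "jinner (A $ i) x - b $ i \<le> max_violation A b x"
  by (simp add: max_violation_def)

text \<open>The event that the oracle keeps its promise. It holds for every answer at a point of negative
maximal violation.\<close>

definition accurate_answer ::
  "real \<Rightarrow> 'a::euclidean_jordan_algebra ^ 'm::finite \<Rightarrow> real ^ 'm \<Rightarrow> 'm list \<Rightarrow> 'm \<Rightarrow> bool" where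
  "accurate_answer \<alpha> A b ps p \<longleftrightarrow>
     (let x = mwu_iterate \<alpha> A ps
      in 0 \<le> max_violation A b x \<longrightarrow> max_violation A b x - \<alpha> / 2 \<le> jinner (A $ p) x - b $ p)"

definition accurate_answers ::
  "real \<Rightarrow> 'a::euclidean_jordan_algebra ^ 'm::finite \<Rightarrow> real ^ 'm \<Rightarrow> 'm list \<Rightarrow> bool" where
  "accurate_answers \<alpha> A b ps \<longleftrightarrow>
     (\<forall>k<length ps. accurate_answer \<alpha> A b (take k ps) (ps ! k))"

lemma accurate_answers_Nil: "accurate_answers \<alpha> A b []"
  by (simp add: accurate_answers_def)

lemma accurate_answers_snoc:
  "accurate_answers \<alpha> A b (ps @ [p]) \<longleftrightarrow> accurate_answers \<alpha> A b ps \<and> accurate_answer \<alpha> A b ps p"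
  by (auto simp: accurate_answers_def nth_append less_Suc_eq all_conj_distrib)

lemma log_partition_mwu_step:
  assumes "0 < width A" "0 < \<alpha>"
  shows "log_partition (mwu_exponent \<alpha> A (ps @ [p])) \<le> log_partition (mwu_exponent \<alpha> A ps)
      - step_size \<alpha> A / width A * jinner (A $ p) (mwu_iterate \<alpha> A ps) + (step_size \<alpha> A)\<^sup>2"
proof -
  define k where "k = step_size \<alpha> A / width A"
  have k: "0 \<le> k" "0 \<le> step_size \<alpha> A" using assms by (simp_all add: k_def step_size_def)
  have "- (k *\<^sub>R A $ p) = (\<Sum>q\<in>spectral_frame (A $ p). (- k * eigval (A $ p) q) *\<^sub>R q)"
    by (subst eigval[of "A $ p"]) (simp add: scaleR_sum_right sum_negf)
  moreover have "\<bar>- k * eigval (A $ p) q\<bar> \<le> step_size \<alpha> A" if "q \<in> spectral_frame (A $ p)" for q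
  proof -
    have "k * \<bar>eigval (A $ p) q\<bar> \<le> k * width A"
      using jnorm_inf_ge[OF that] jnorm_inf_le_width[of A p] k by (intro mult_left_mono) auto
    then show ?thesis using assms k by (simp add: abs_mult k_def)
  qed
  ultimately have "log_partition (mwu_exponent \<alpha> A ps + - (k *\<^sub>R A $ p))
      \<le> log_partition (mwu_exponent \<alpha> A ps)
        + jinner (gibbs (mwu_exponent \<alpha> A ps)) (- (k *\<^sub>R A $ p)) + (step_size \<alpha> A)\<^sup>2"
    by (rule log_partition_smooth[OF spectral_frame])
  then show ?thesis
    by (simp add: mwu_exponent_snoc mwu_iterate_eq_gibbs k_def jinner_linear jinner_commute)
qed

text \<open>The comparator \<open>z\<close> is feasible, and \<open>E\<close> normalizes the potential \<open>\<Phi> y - \<langle>z, y\<rangle> + E\<close> to be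
nonnegative. An accurate answer lowers the potential, weighted by \<open>K\<close>, by the violation minus
\<open>\<alpha>/2 + \<alpha>/4\<close>, where \<open>\<alpha>/2\<close> is the error of the oracle and \<open>\<alpha>/4 = K \<eta>\<^sup>2\<close> the error of the smoothness
bound. In a round of negative maximal violation the potential is discarded, which is possible because it is
nonnegative, and restarted at 0 with the current iterate as comparator.\<close>

lemma mwu_potential:
  fixes A :: "'a::euclidean_jordan_algebra ^ 'm::finite"
  assumes w: "0 < width A" and a: "0 < \<alpha>"
    and z0: "z0 \<in> cone_of_squares" "jtrace z0 = 1" "\<And>i. jinner (A $ i) z0 \<le> b $ i"
    and acc: "accurate_answers \<alpha> A b ps"
  defines "K \<equiv> 4 * (width A)\<^sup>2 / \<alpha>"
  shows "\<exists>z E. (\<forall>i. jinner (A $ i) z \<le> b $ i) \<and> (\<forall>y. 0 \<le> log_partition y - jinner z y + E) \<and>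
    (\<Sum>t<length ps. max_violation A b (mwu_iterate \<alpha> A (take t ps)))
      + K * (log_partition (mwu_exponent \<alpha> A ps) - jinner z (mwu_exponent \<alpha> A ps) + E)
    \<le> real (length ps) * (3 * \<alpha> / 4) + K * ln (real (jrank TYPE('a)))"
  using acc
proof (induction ps rule: rev_induct)
  case Nil
  have e: "mwu_exponent \<alpha> A [] = 0" by (simp add: mwu_exponent_def)
  show ?case
    using z0 log_partition_ge[OF z0(1,2)]
    by (intro exI[of _ z0] exI[of _ 0]) (simp add: e log_partition_zero jinner_linear)
next
  case (snoc p ps)
  let ?x = "mwu_iterate \<alpha> A ps"
  let ?y = "mwu_exponent \<alpha> A ps"
  let ?y' = "mwu_exponent \<alpha> A (ps @ [p])"
  let ?S = "\<lambda>ps. \<Sum>t<length ps. max_violation A b (mwu_iterate \<alpha> A (take t ps))"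
  define \<eta> where "\<eta> = step_size \<alpha> A"
  have K: "0 < K" and Kc: "K * (\<eta> / width A) = 1" and K2: "K * \<eta>\<^sup>2 = \<alpha> / 4"
    using w a by (simp_all add: K_def \<eta>_def step_size_def power2_eq_square field_simps)
  have acc: "accurate_answers \<alpha> A b ps" "accurate_answer \<alpha> A b ps p"
    using snoc.prems by (simp_all add: accurate_answers_snoc)
  obtain z E where z: "\<And>i. jinner (A $ i) z \<le> b $ i"
    and E: "\<And>y. 0 \<le> log_partition y - jinner z y + E"
    and IH: "?S ps + K * (log_partition ?y - jinner z ?y + E)
      \<le> real (length ps) * (3 * \<alpha> / 4) + K * ln (real (jrank TYPE('a)))"
    using snoc.IH[OF acc(1)] by auto
  have S: "?S (ps @ [p]) = ?S ps + max_violation A b ?x" by simp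
  have y': "jinner u ?y' = jinner u ?y - \<eta> / width A * jinner (A $ p) u" for u
    by (simp add: mwu_exponent_snoc jinner_linear \<eta>_def jinner_commute)
  have step: "K * (log_partition ?y' - jinner u ?y' + c)
      \<le> K * (log_partition ?y - jinner u ?y + c) - (jinner (A $ p) ?x - jinner (A $ p) u) + \<alpha> / 4"
    for u c
  proof -
    have "K * (log_partition ?y' - jinner u ?y' + c)
        \<le> K * (log_partition ?y - \<eta> / width A * jinner (A $ p) ?x + \<eta>\<^sup>2
           - (jinner u ?y - \<eta> / width A * jinner (A $ p) u) + c)"
      using log_partition_mwu_step[OF w a, of ps p] K unfolding y'
      by (intro mult_left_mono) (simp_all add: \<eta>_def)
    also have "\<dots> = K * (log_partition ?y - jinner u ?y + c)
        - K * (\<eta> / width A) * (jinner (A $ p) ?x - jinner (A $ p) u) + K * \<eta>\<^sup>2"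
      by (simp add: algebra_simps)
    finally show ?thesis unfolding Kc K2 by simp
  qed
  show ?case
  proof (cases "0 \<le> max_violation A b ?x")
    case True
    then have "max_violation A b ?x - \<alpha> / 2 \<le> jinner (A $ p) ?x - b $ p"
      using acc(2) by (simp add: accurate_answer_def Let_def)
    then have "?S (ps @ [p]) + K * (log_partition ?y' - jinner z ?y' + E)
      \<le> real (length (ps @ [p])) * (3 * \<alpha> / 4) + K * ln (real (jrank TYPE('a)))"
      using step[of z E] z[of p] IH unfolding S by (simp add: field_simps)
    then show ?thesis using z E by blast
  next
    case False
    let ?E = "jinner ?x ?y - log_partition ?y"
    have "jinner (A $ i) ?x \<le> b $ i" for i
      using max_violation_ge[of A i ?x b] False by simp
    moreover have "0 \<le> log_partition y - jinner ?x y + ?E" for y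
      using log_partition_convex[of ?y "y - ?y"] by (simp add: mwu_iterate_eq_gibbs jinner_linear)
    moreover have "?S (ps @ [p]) + K * (log_partition ?y' - jinner ?x ?y' + ?E)
      \<le> real (length (ps @ [p])) * (3 * \<alpha> / 4) + K * ln (real (jrank TYPE('a)))"
    proof -
      have "K * (log_partition ?y' - jinner ?x ?y' + ?E) \<le> \<alpha> / 4"
        using step[of ?x ?E] by simp
      moreover have "0 \<le> K * (log_partition ?y - jinner z ?y + E)" using K E by simp
      ultimately show ?thesis using IH False a unfolding S by (simp add: field_simps)
    qed
    ultimately show ?thesis by blast
  qed
qed

lemma mwu_average_le:
  fixes A :: "'a::euclidean_jordan_algebra ^ 'm::finite"
  assumes a: "0 < \<alpha>"
    and z0: "z0 \<in> cone_of_squares" "jtrace z0 = 1" "\<And>i. jinner (A $ i) z0 \<le> b $ i"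
    and acc: "accurate_answers \<alpha> A b ps" and T: "length ps = num_rounds \<alpha> A"
  defines "T \<equiv> num_rounds \<alpha> A"
  shows "jinner (A $ i) ((1 / real T) *\<^sub>R (\<Sum>t<T. mwu_iterate \<alpha> A (take t ps))) \<le> b $ i + \<alpha>"
proof (cases "width A = 0")
  case True
  then have "A $ i = 0" by (rule width_zero)
  then show ?thesis using z0(3)[of i] a by (simp add: jinner_linear)
next
  case False
  then have w: "0 < width A" using width_nonneg[of A] by simp
  define K where "K = 4 * (width A)\<^sup>2 / \<alpha>"
  have K: "0 < K" using w a by (simp add: K_def)
  define r where "r = real (jrank TYPE('a))"
  have Tpos: "0 < real T" by (simp add: T_def num_rounds_def)
  have "4 * K * ln r / \<alpha> \<le> real T"
  proof -
    have "4 * K * ln r / \<alpha> = 16 * (width A)\<^sup>2 * ln r / \<alpha>\<^sup>2"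
      by (simp add: K_def power2_eq_square)
    also have "\<dots> \<le> real T"
      unfolding T_def num_rounds_def r_def[symmetric] by linarith
    finally show ?thesis .
  qed
  then have Kr: "K * ln r \<le> real T * (\<alpha> / 4)" using a by (simp add: field_simps)
  let ?x = "\<lambda>t. mwu_iterate \<alpha> A (take t ps)"
  obtain z E where E: "\<And>y. 0 \<le> log_partition y - jinner z y + E"
    and pot: "(\<Sum>t<T. max_violation A b (?x t))
        + K * (log_partition (mwu_exponent \<alpha> A ps) - jinner z (mwu_exponent \<alpha> A ps) + E)
      \<le> real T * (3 * \<alpha> / 4) + K * ln r"
    using mwu_potential[OF w a z0 acc] T unfolding K_def r_def T_def by auto
  have "(\<Sum>t<T. jinner (A $ i) (?x t) - b $ i) \<le> (\<Sum>t<T. max_violation A b (?x t))"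
    by (intro sum_mono max_violation_ge)
  also have "\<dots> \<le> real T * (3 * \<alpha> / 4) + K * ln r"
    using pot mult_nonneg_nonneg[OF less_imp_le[OF K] E[of "mwu_exponent \<alpha> A ps"]] by linarith
  also have "\<dots> \<le> real T * \<alpha>" using Kr by linarith
  finally have "(\<Sum>t<T. jinner (A $ i) (?x t)) \<le> real T * (b $ i + \<alpha>)"
    by (simp add: sum_subtractf algebra_simps)
  then show ?thesis
    using Tpos by (simp add: jinner_linear jinner_sum_right divide_simps mult.commute)
qed

lemma length_mwu_answers: "ps \<in> set_pmf (mwu_answers D \<alpha> A b t) \<Longrightarrow> length ps = t"
  by (induction t arbitrary: ps) auto

lemma mwu_iterate_in_cone: "mwu_iterate \<alpha> A ps \<in> cone_of_squares"
  by (simp add: mwu_iterate_eq_gibbs gibbs_in_cone)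

lemma inaccurate_answer_prob:
  assumes D: "dual_oracle (\<alpha> / 2) \<gamma> D" and g: "0 \<le> \<gamma>"
  shows "measure_pmf.prob (D A b (mwu_iterate \<alpha> A ps)) {p. \<not> accurate_answer \<alpha> A b ps p} \<le> \<gamma>"
proof (cases "0 \<le> max_violation A b (mwu_iterate \<alpha> A ps)")
  case True
  let ?x = "mwu_iterate \<alpha> A ps"
  let ?M = "D A b ?x"
  have "{p. accurate_answer \<alpha> A b ps p}
      = {p. jinner (A $ p) ?x - b $ p \<ge> (MAX j. jinner (A $ j) ?x - b $ j) - \<alpha> / 2}"
    using True by (simp add: accurate_answer_def Let_def max_violation_def)
  moreover have "measure_pmf.prob ?M
      {p. jinner (A $ p) ?x - b $ p \<ge> (MAX j. jinner (A $ j) ?x - b $ j) - \<alpha> / 2} \<ge> 1 - \<gamma>"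
    using D mwu_iterate_in_cone[of \<alpha> A ps] True unfolding dual_oracle_def max_violation_def by blast
  ultimately have "1 - \<gamma> \<le> measure_pmf.prob ?M {p. accurate_answer \<alpha> A b ps p}" by simp
  also have "\<dots> = 1 - measure_pmf.prob ?M {p. \<not> accurate_answer \<alpha> A b ps p}"
    using measure_pmf.prob_compl[of "{p. \<not> accurate_answer \<alpha> A b ps p}" ?M]
    by (simp add: Compl_eq_Diff_UNIV[symmetric] Collect_neg_eq)
  finally show ?thesis by simp
qed (simp add: accurate_answer_def Let_def g)

text \<open>A union bound over the rounds: the failure probability grows by at most \<open>\<gamma>\<close> when one
answer is appended.\<close>

lemma inaccurate_answers_prob:
  assumes D: "dual_oracle (\<alpha> / 2) \<gamma> D" and g: "0 \<le> \<gamma>"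
  shows "measure_pmf.prob (mwu_answers D \<alpha> A b t) {ps. \<not> accurate_answers \<alpha> A b ps} \<le> real t * \<gamma>"
proof -
  let ?F = "{ps. \<not> accurate_answers \<alpha> A b ps}"
  have "emeasure (mwu_answers D \<alpha> A b t) ?F \<le> ennreal (real t * \<gamma>)"
  proof (induction t)
    case 0
    then show ?case by (simp add: accurate_answers_Nil)
  next
    case (Suc t)
    let ?P = "mwu_answers D \<alpha> A b t"
    have "emeasure (map_pmf (\<lambda>p. ps @ [p]) (D A b (mwu_iterate \<alpha> A ps))) ?F
        \<le> indicator ?F ps + ennreal \<gamma>" for ps
    proof (cases "accurate_answers \<alpha> A b ps")
      case True
      then show ?thesis
        using inaccurate_answer_prob[OF D g, of A b ps]
        by (simp add: accurate_answers_snoc vimage_def measure_pmf.emeasure_eq_measure ennreal_leI)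
    next
      case False
      then have "emeasure (map_pmf (\<lambda>p. ps @ [p]) (D A b (mwu_iterate \<alpha> A ps))) ?F
          \<le> indicator ?F ps + 0"
        using measure_pmf.emeasure_le_1 by (simp del: emeasure_map_pmf)
      then show ?thesis by (rule order_trans) (intro add_left_mono, simp)
    qed
    then have "emeasure (mwu_answers D \<alpha> A b (Suc t)) ?F
        \<le> (\<integral>\<^sup>+ps. indicator ?F ps + ennreal \<gamma> \<partial>?P)"
      by (auto intro: nn_integral_mono simp del: emeasure_map_pmf)
    also have "\<dots> = emeasure ?P ?F + ennreal \<gamma>"
      by (subst nn_integral_add) auto
    also have "\<dots> \<le> ennreal (real t * \<gamma>) + ennreal \<gamma>"
      by (intro add_right_mono Suc.IH)
    also have "\<dots> = ennreal (real (Suc t) * \<gamma>)"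
      using g by (simp add: algebra_simps flip: ennreal_plus)
    finally show ?case .
  qed
  then show ?thesis using g by (simp add: measure_pmf.emeasure_eq_measure)
qed

theorem theoremC2:
  fixes A :: "'a::euclidean_jordan_algebra ^ 'm::finite"
    and b :: "real ^ 'm"
    and \<alpha> \<gamma> :: real
    and D :: "'a ^ 'm \<Rightarrow> real ^ 'm \<Rightarrow> 'a \<Rightarrow> 'm pmf"
  assumes "\<alpha> > 0" and "\<gamma> > 0"
    and "dual_oracle (\<alpha> / 2) \<gamma> D"
    and "\<exists>x\<in>cone_of_squares. jtrace x = 1 \<and> (\<forall>i. jinner (A $ i) x \<le> b $ i)"
  shows "(\<forall>xbar\<in>set_pmf (mwu_output D \<alpha> A b). xbar \<in> cone_of_squares) \<and>
         measure_pmf.prob (mwu_output D \<alpha> A b) {xbar. \<forall>i. jinner (A $ i) xbar \<le> b $ i + \<alpha>}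
           \<ge> 1 - real (num_rounds \<alpha> A) * \<gamma>"
proof
  define T where "T = num_rounds \<alpha> A"
  define avg where "avg ps = (1 / real T) *\<^sub>R (\<Sum>t<T. mwu_iterate \<alpha> A (take t ps))" for ps
  let ?P = "mwu_answers D \<alpha> A b T"
  have out: "mwu_output D \<alpha> A b = map_pmf avg ?P"
    unfolding mwu_output_def Let_def T_def avg_def ..
  have "avg ps \<in> cone_of_squares" for ps
    unfolding avg_def by (intro cone_of_squares_scaleR cone_of_squares_sum mwu_iterate_in_cone) simp
  then show "\<forall>xbar\<in>set_pmf (mwu_output D \<alpha> A b). xbar \<in> cone_of_squares"
    by (auto simp: out)
  obtain z0 where z0: "z0 \<in> cone_of_squares" "jtrace z0 = 1" "\<And>i. jinner (A $ i) z0 \<le> b $ i"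
    using assms(4) by blast
  let ?G = "{ps. accurate_answers \<alpha> A b ps}"
  let ?H = "{ps. \<forall>i. jinner (A $ i) (avg ps) \<le> b $ i + \<alpha>}"
  have "ps \<in> ?G \<longrightarrow> ps \<in> ?H" if "ps \<in> set_pmf ?P" for ps
    using mwu_average_le[OF assms(1) z0, of ps] length_mwu_answers[OF that]
    unfolding avg_def T_def by blast
  then have "measure_pmf.prob ?P ?G \<le> measure_pmf.prob ?P ?H"
    by (intro measure_pmf.finite_measure_mono_AE) (simp_all add: AE_measure_pmf_iff)
  moreover have "measure_pmf.prob ?P ?G = 1 - measure_pmf.prob ?P {ps. \<not> accurate_answers \<alpha> A b ps}"
    using measure_pmf.prob_compl[of "{ps. \<not> accurate_answers \<alpha> A b ps}" ?P]
    by (simp add: Compl_eq_Diff_UNIV[symmetric] Collect_neg_eq)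
  moreover have "measure_pmf.prob ?P {ps. \<not> accurate_answers \<alpha> A b ps} \<le> real T * \<gamma>"
    using assms(2,3) by (intro inaccurate_answers_prob) simp_all
  ultimately show "measure_pmf.prob (mwu_output D \<alpha> A b) {xbar. \<forall>i. jinner (A $ i) xbar \<le> b $ i + \<alpha>}
           \<ge> 1 - real (num_rounds \<alpha> A) * \<gamma>"
    by (simp add: out vimage_def T_def)
qed

end
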